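(* Let $f(x)=\lambda x+\sum_{i\ge2,\ p\mid i}a_ix^i\in\mathcal{F}^p_{\lambda,a}(K)$, with conjugacy function $g$, and let $\sigma=|1-\lambda^m|^{\frac1{k'-1}}/a$. Suppose $a=|a_{k'}|^{1/(k'-1)}$ and $|a_i|<a^{i-1}$ for all $2\le i<k'$. Then $D_\sigma(0)$ is the linearization disc of $f$ about the origin. In $\widehat K$ we have $\deg(g,\overline D_\sigma(0))=k'$. Furthermore, $f$ has an indifferent periodic point in $\widehat K$ on the sphere $S_\sigma(0)$ of period $\kappa\le k'$, with multiplier $\lambda^\kappa$.
   Context: $K$ is a field of characteristic $p>0$, complete with respect to a nontrivial absolute value $|\cdot|$ (necessarily non-Archimedean), and $\widehat K$ is the completion of the algebraic closure of $K$ with the extended absolute value. $D_r(0)$, $\overline D_r(0)$, $S_r(0)$ denote the open disc $|x|<r$, closed disc $|x|\le r$ and sphere $|x|=r$. The element $\lambda\in K$ is not a root of unity and is such that $m=m(\lambda)=\min\{n\in\mathbb Z:n\ge1,\ |1-\lambda^n|<1\}$ exists (so $|\lambda|=1$; one has $p\nmid m$). $k'=k'(\lambda)=\min\{k\in\mathbb Z:k\ge1,\ p\mid k,\ m\mid k-1\}$. For a real number $a>0$, \[ \mathcal F^p_{\lambda,a}(K)=\Big\{\lambda x+\sum_{i\ge2,\ p\mid i}a_ix^i\in K[[x]]:\ a=\sup_{i\ge2}|a_i|^{1/(i-1)}\Big\}. \] The conjugacy function $g$ of $f$ is the unique power series solution, with $g(0)=0$ and $g'(0)=1$, of $g\circ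 f(x)=\lambda g(x)$. The linearization disc of $f$ about the origin is the maximal disc $U\subset K$ about $0$ such that the full conjugacy $g\circ f\circ g^{-1}(x)=\lambda x$ holds for all $x\in U$ (meaning that $g$ converges and is one-to-one on $U$, the compositional inverse power series $g^{-1}$ converges on $U$, and $g(f(g^{-1}(x)))=\lambda x$ on $U$). For a power series $h(x)=\sum_{k\ge0}c_kx^k$ converging on $\overline D_r(0)\subset\widehat K$, $r\in|\widehat K^*|$, with $s=\max_k|c_k|r^k$, the Weierstrass degree is $\deg(h,\overline D_r(0))=\max\{k\ge0:|c_k|r^k=s\}$. A periodic point $\hat x$ of period $\kappa$ has multiplier $(f^{\circ\kappa})'(\hat x)$ and is indifferent if the multiplier has absolute value $1$. *)

theory Defs
  imports
    "HOL-Analysis.Elementary_Metric_Spaces"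
    "HOL-Computational_Algebra.Formal_Power_Series"
    "HOL-Algebra.Algebraic_Closure_Type"
begin

text \<open>
  The classes for normed fields in the library, and the type of \<open>norm\<close>, presuppose a real vector
  space and hence exclude positive characteristic. In the class below the metric axioms give
  the remaining properties of an absolute value (see the lemma). Completeness is
  the library class \<open>complete_space\<close>.
\<close>

class abs_value_field = field + metric_space +
  fixes absval :: "'a \<Rightarrow> real"
  assumes dist_absval: "dist x y = absval (x - y)"
    and absval_mult: "absval (x * y) = absval x * absval y"

lemma abs_value_field_axioms:
  fixes x y :: "'a::abs_value_field"
  shows "0 \<le> absval x" and "absval x = 0 \<longleftrightarrow> x = 0" and "absval (x + y) \<le> absval x + absval y"
proof -
  have eq: "absval z = dist z 0" for z :: 'a
    by (simp add: dist_absval)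
  show "0 \<le> absval x" "absval x = 0 \<longleftrightarrow> x = 0"
    by (simp_all add: eq)
  have "absval (x + y) = dist x (- y)"
    by (simp add: dist_absval)
  also have "\<dots> \<le> dist x 0 + dist (- y) 0"
    by (rule dist_triangle2)
  also have "dist (- y) 0 = dist 0 y"
    by (simp add: dist_absval)
  finally show "absval (x + y) \<le> absval x + absval y"
    by (simp add: eq dist_commute)
qed

text \<open>
  The completion of the algebraic closure is unique only up to isometric isomorphism. A model of it
  is a complete valued field \<open>'c\<close> together with a field embedding \<open>\<iota>\<close> of the algebraic closure
  with dense image, such that the absolute value of \<open>'c\<close> extends the one of \<open>'a\<close>.
\<close>

definition completed_alg_closure ::
    "('a::{abs_value_field, complete_space} alg_closure \<Rightarrow> 'c::{abs_value_field, complete_space}) \<Rightarrow> bool"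
  where "completed_alg_closure \<iota> \<longleftrightarrow>
    \<iota> 1 = 1 \<and> (\<forall>x y. \<iota> (x + y) = \<iota> x + \<iota> y) \<and> (\<forall>x y. \<iota> (x * y) = \<iota> x * \<iota> y) \<and>
    (\<forall>x. absval (\<iota> (to_ac x)) = absval x) \<and> closure (range \<iota>) = UNIV"

definition fps_map :: "('a::zero \<Rightarrow> 'c::zero) \<Rightarrow> 'a fps \<Rightarrow> 'c fps"
  where "fps_map \<phi> h = Abs_fps (\<lambda>n. \<phi> (fps_nth h n))"

definition fps_converges :: "'a::abs_value_field fps \<Rightarrow> 'a \<Rightarrow> bool"
  where "fps_converges h x \<longleftrightarrow> summable (\<lambda>n. fps_nth h n * x ^ n)"

definition fps_value :: "'a::abs_value_field fps \<Rightarrow> 'a \<Rightarrow> 'a"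
  where "fps_value h x = (\<Sum>n. fps_nth h n * x ^ n)"

definition mult_order_residue :: "'a::abs_value_field \<Rightarrow> nat"
  where "mult_order_residue l = (LEAST n. n \<ge> 1 \<and> absval (1 - l ^ n) < 1)"

definition min_resonance :: "nat \<Rightarrow> 'a::abs_value_field \<Rightarrow> nat"
  where "min_resonance p l = (LEAST k. k \<ge> 1 \<and> p dvd k \<and> mult_order_residue l dvd k - 1)"

text \<open>Real suprema of unbounded sets are unspecified, whence the explicit boundedness condition.\<close>

definition series_family :: "nat \<Rightarrow> 'a::abs_value_field \<Rightarrow> real \<Rightarrow> 'a fps set"
  where "series_family p l a = {f.
    fps_nth f 0 = 0 \<and> fps_nth f 1 = l \<and> (\<forall>i\<ge>2. \<not> p dvd i \<longrightarrow> fps_nth f i = 0) \<and>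
    bdd_above ((\<lambda>i. absval (fps_nth f i) powr (1 / real (i - 1))) ` {2..}) \<and>
    a = (SUP i\<in>{2..}. absval (fps_nth f i) powr (1 / real (i - 1)))}"

definition conjugacy :: "'a::field fps \<Rightarrow> 'a fps"
  where "conjugacy f = (THE g. fps_nth g 0 = 0 \<and> fps_nth g 1 = 1 \<and>
    fps_compose g f = fps_const (fps_nth f 1) * g)"

text \<open>
  \<open>fps_inv g\<close> is the compositional inverse series. Since \<open>fps_value\<close> is a total function,
  convergence of every evaluated series is part of the definition.
\<close>

definition full_conjugacy_on :: "'a::abs_value_field fps \<Rightarrow> 'a set \<Rightarrow> bool"
  where "full_conjugacy_on f U \<longleftrightarrow> (let g = conjugacy f in
    (\<forall>x\<in>U. fps_converges g x) \<and> inj_on (fps_value g) U \<and>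
    (\<forall>x\<in>U. let y = fps_value (fps_inv g) x in
      fps_converges (fps_inv g) x \<and> fps_converges f y \<and> fps_converges g (fps_value f y) \<and>
      fps_value g (fps_value f y) = fps_nth f 1 * x))"

definition disc_at_0 :: "'a::abs_value_field set \<Rightarrow> bool"
  where "disc_at_0 U \<longleftrightarrow> (\<exists>r>0. U = ball 0 r \<or> U = cball 0 r)"

text \<open>Discs about 0 are linearly ordered by inclusion, so a maximal one is a greatest one.\<close>

definition linearization_disc :: "'a::abs_value_field fps \<Rightarrow> 'a set \<Rightarrow> bool"
  where "linearization_disc f U \<longleftrightarrow> disc_at_0 U \<and> full_conjugacy_on f U \<and>
    (\<forall>V. disc_at_0 V \<and> full_conjugacy_on f V \<longrightarrow> V \<subseteq> U)"

text \<open>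
  The Weierstrass degree is only defined for a radius in the value group and a series
  converging on the closed disc; the relation below includes both requirements.
\<close>

definition has_weierstrass_degree :: "'c::abs_value_field fps \<Rightarrow> real \<Rightarrow> nat \<Rightarrow> bool"
  where "has_weierstrass_degree h r d \<longleftrightarrow>
    r \<in> absval ` (UNIV - {0 :: 'c}) \<and> (\<forall>x\<in>cball 0 r. fps_converges h x) \<and>
    (let s = (SUP k. absval (fps_nth h k) * r ^ k); M = {k. absval (fps_nth h k) * r ^ k = s}
     in finite M \<and> M \<noteq> {} \<and> d = Max M)"

text \<open>The period is the least one.\<close>

definition periodic_point :: "'c::abs_value_field fps \<Rightarrow> nat \<Rightarrow> 'c \<Rightarrow> bool"
  where "periodic_point h n z \<longleftrightarrow> n \<ge> 1 \<and>
    (\<forall>j<n. fps_converges h ((fps_value h ^^ j) z)) \<and>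
    (fps_value h ^^ n) z = z \<and> (\<forall>j. 1 \<le> j \<and> j < n \<longrightarrow> (fps_value h ^^ j) z \<noteq> z)"

definition has_multiplier :: "'c::abs_value_field fps \<Rightarrow> nat \<Rightarrow> 'c \<Rightarrow> 'c \<Rightarrow> bool"
  where "has_multiplier h n z \<mu> \<longleftrightarrow>
    ((\<lambda>y. ((fps_value h ^^ n) y - (fps_value h ^^ n) z) / (y - z)) \<longlongrightarrow> \<mu>) (at z)"

definition indifferent_periodic_point :: "'c::abs_value_field fps \<Rightarrow> nat \<Rightarrow> 'c \<Rightarrow> bool"
  where "indifferent_periodic_point h n z \<longleftrightarrow>
    periodic_point h n z \<and> (\<exists>\<mu>. has_multiplier h n z \<mu> \<and> absval \<mu> = 1)"

end

theory Submission
  imports Defs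
begin

text \<open>
  Write \<open>\<lambda>\<close> for \<open>l\<close> and \<open>b\<^sub>n\<close> for the coefficients of the conjugacy \<open>g\<close>. All three assertions follow
  from bounds on the \<open>b\<^sub>n\<close> that determine the Gauss norm and the Weierstrass degree of \<open>g\<close> on the
  closed disc of radius \<open>\<sigma>\<close>.

  The conjugacy equation is the recursion
  \<open>b\<^sub>n (\<lambda> - \<lambda>^n) = (\<Sum>j<n. b\<^sub>j [x^n] f^j)\<close>, so the size of \<open>b\<^sub>n\<close> is governed by the small divisors
  \<open>1 - \<lambda>^(n - 1)\<close>. In characteristic \<open>p\<close> these can be as small as \<open>\<bar>1 - \<lambda>^m\<bar>^(p^s)\<close>, but the
  very small ones do not occur. Indeed \<open>f' = \<lambda>\<close>, since all exponents of \<open>f\<close> beyond the first are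
  divisible by \<open>p\<close>; differentiating \<open>g \<circ> f = \<lambda> g\<close> shows that \<open>g'\<close> is invariant under \<open>f\<close>, hence
  constant, and so \<open>b\<^sub>n = 0\<close> for \<open>n \<ge> 2\<close> not divisible by \<open>p\<close> (\<open>conjugacy_exponents\<close>). For
  \<open>p dvd n\<close> the divisor has absolute value \<open>d = \<bar>1 - \<lambda>^m\<bar>\<close> if \<open>m dvd n - 1\<close> and \<open>1\<close> otherwise. The
  resonant indices are \<open>k, k + m p, k + 2 m p, \<dots>\<close>, and each costs one factor \<open>1 / d\<close>
  (\<open>coeff_bound\<close>). Because \<open>k - 1 < m p\<close>, the first resonance is reached faster than the later ones
  follow, so \<open>\<bar>b\<^sub>n\<bar> \<sigma>^n < \<sigma>\<close> except for \<open>n = 1\<close> and \<open>n = k\<close>, where equality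
  holds; moreover \<open>g\<close> converges on a disc of radius \<open>r > \<sigma>\<close> (\<open>gauss_degree_g\<close>, \<open>gauss_bound_g\<close>).

  On the open disc of radius \<open>\<sigma>\<close> the series \<open>g\<close> is an isometry, which gives the full conjugacy. It cannot be
  extended: if the inverse series \<open>c\<close> converged at a point with \<open>\<bar>x\<bar> \<ge> \<sigma>\<close>, it would have a finite
  Weierstrass degree \<open>N \<ge> 1\<close> on the closed disc of radius \<open>\<sigma>\<close>, and \<open>g \<circ> c = x\<close> would have
  degree \<open>k N > 1\<close> (\<open>inverse_series_diverges\<close>). This argument takes place in \<open>K\<close> itself.

  For the periodic point, choose \<open>z\<^sub>0 \<noteq> 0\<close> in the algebraic closure with \<open>z\<^sub>0 + b\<^sub>k z\<^sub>0^k = 0\<close>. Then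
  \<open>\<bar>g(z\<^sub>0)\<bar> < \<sigma>\<close>, and since \<open>g' = 1\<close> the map \<open>x - g(x)\<close> is a contraction near \<open>z\<^sub>0\<close>; its fixed
  point is a zero \<open>z\<close> of \<open>g\<close> on the sphere (\<open>zero_on_sphere\<close>). The equation \<open>g \<circ> f = \<lambda> g\<close> makes all
  iterates of \<open>z\<close> zeros of \<open>g\<close>. On the sphere \<open>f\<close> is close to the rotation by \<open>\<lambda>\<close>, so \<open>f^m(z)\<close> is
  nearer than \<open>\<sigma>\<close> to \<open>\<lambda>^m z\<close> and hence to \<open>z\<close>. As \<open>g\<close> is injective on such residue discs, \<open>f^m(z) = z\<close>
  (\<open>zero_is_periodic\<close>), and \<open>m \<le> k - 1\<close>. The multiplier is \<open>\<lambda>^\<kappa>\<close> because \<open>f' = \<lambda>\<close>.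
\<close>

unbundle fps_syntax

section \<open>Absolute values on fields of positive characteristic\<close>

lemma absval_nonneg [simp]: "0 \<le> absval (x :: 'a::abs_value_field)"
  by (rule abs_value_field_axioms(1))

lemma absval_eq_0_iff [simp]: "absval (x :: 'a::abs_value_field) = 0 \<longleftrightarrow> x = 0"
  by (rule abs_value_field_axioms(2))

lemma absval_0 [simp]: "absval (0 :: 'a::abs_value_field) = 0"
  by simp

lemma absval_1 [simp]: "absval (1 :: 'a::abs_value_field) = 1"
proof -
  have "absval (1::'a) * absval (1::'a) = absval (1::'a) * 1"
    unfolding absval_mult[symmetric] by simp
  moreover have "absval (1::'a) \<noteq> 0"
    by simp
  ultimately show ?thesis
    by (simp only: mult_cancel_left) simp
qed

lemma absval_power [simp]: "absval (x ^ n :: 'a::abs_value_field) = absval x ^ n"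
  by (induction n) (simp_all add: absval_mult)

lemma absval_diff_commute: "absval (x - y :: 'a::abs_value_field) = absval (y - x)"
  by (metis dist_absval dist_commute)

lemma absval_minus [simp]: "absval (- x :: 'a::abs_value_field) = absval x"
  using absval_diff_commute[of 0 x] by simp

lemma absval_divide: "absval (x / y :: 'a::abs_value_field) = absval x / absval y"
proof (cases "y = 0")
  case False
  have "absval (x / y) * absval y = absval x"
    using False by (simp flip: absval_mult)
  then show ?thesis
    using False by (simp add: field_simps)
qed simp

lemma dist_0_absval [simp]: "dist 0 x = absval (x :: 'a::abs_value_field)" "dist x 0 = absval x"
  by (simp_all add: dist_absval)

lemma tendsto_absval_iff:
  fixes f :: "'b \<Rightarrow> 'a::abs_value_field"
  shows "(f \<longlongrightarrow> a) F \<longleftrightarrow> ((\<lambda>x. absval (f x - a)) \<longlongrightarrow> 0) F"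
  by (subst tendsto_dist_iff) (simp add: dist_absval)

lemma tendsto_absval_le:
  fixes f :: "'b \<Rightarrow> 'a::abs_value_field"
  assumes "eventually (\<lambda>x. absval (f x - a) \<le> g x) F" "(g \<longlongrightarrow> 0) F"
  shows "(f \<longlongrightarrow> a) F"
  unfolding tendsto_absval_iff
  by (rule tendsto_sandwich[OF _ assms(1) tendsto_const assms(2)]) simp

text \<open>
  With these two class inclusions the limit laws for sums and products apply to partial sums of
  power series.
\<close>

instance abs_value_field < topological_ab_group_add
proof
  fix a b :: 'a
  have "((\<lambda>x. absval (fst x - a) + absval (snd x - b)) \<longlongrightarrow> 0) (nhds a \<times>\<^sub>F nhds b)"
    using tendsto_add[OF filterlim_fst[of "nhds a" "nhds b", unfolded tendsto_absval_iff]
        filterlim_snd[where F = "nhds a" and G = "nhds b", unfolded tendsto_absval_iff]]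
    by simp
  moreover have "absval (fst x + snd x - (a + b)) \<le> absval (fst x - a) + absval (snd x - b)" for x
    using abs_value_field_axioms(3)[of "fst x - a" "snd x - b"] by (simp add: algebra_simps)
  ultimately show "((\<lambda>x. fst x + snd x) \<longlongrightarrow> a + b) (nhds a \<times>\<^sub>F nhds b)"
    by (intro tendsto_absval_le[where g = "\<lambda>x. absval (fst x - a) + absval (snd x - b)"]) auto
next
  fix a :: 'a
  have "((\<lambda>x. x) \<longlongrightarrow> a) (nhds a)"
    by (rule filterlim_ident)
  moreover have "absval (- x - - a) = absval (x - a)" for x
    using absval_minus[of "x - a"] by simp
  ultimately show "(uminus \<longlongrightarrow> - a) (nhds a)"
    by (simp add: tendsto_absval_iff)
qed

instance abs_value_field < topological_semigroup_mult
proof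
  fix a b :: 'a
  let ?F = "nhds a \<times>\<^sub>F nhds b"
  have A: "((\<lambda>x. absval (fst x - a)) \<longlongrightarrow> 0) ?F" and B: "((\<lambda>x. absval (snd x - b)) \<longlongrightarrow> 0) ?F"
    using filterlim_fst[where F = "nhds a" and G = "nhds b"]
      filterlim_snd[where F = "nhds a" and G = "nhds b"]
    by (simp_all only: tendsto_absval_iff)
  let ?g = "\<lambda>x. absval (fst x - a) * absval (snd x - b) + absval (fst x - a) * absval b
     + absval a * absval (snd x - b)"
  have "(?g \<longlongrightarrow> 0 * 0 + 0 * absval b + absval a * 0) ?F"
    by (intro tendsto_intros A B)
  then have g: "(?g \<longlongrightarrow> 0) ?F"
    by simp
  have "absval (fst x * snd x - a * b) \<le> ?g x" for x
  proof -
    have "fst x * snd x - a * b = (fst x - a) * (snd x - b) + (fst x - a) * b + a * (snd x - b)"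
      by (simp add: algebra_simps)
    then show ?thesis
      using abs_value_field_axioms(3)[of "(fst x - a) * (snd x - b) + (fst x - a) * b" "a * (snd x - b)"]
        abs_value_field_axioms(3)[of "(fst x - a) * (snd x - b)" "(fst x - a) * b"]
      by (simp add: absval_mult)
  qed
  then show "((\<lambda>x. fst x * snd x) \<longlongrightarrow> a * b) ?F"
    by (intro tendsto_absval_le[OF _ g]) auto
qed

lemma closed_absval_le: "closed {x :: 'a::abs_value_field. absval x \<le> B}"
  using closed_cball[of "0::'a" B] by (simp add: cball_def)

context
  assumes char_pos: "CHAR('a::abs_value_field) > 0"
begin

text \<open>
  The Frobenius map gives \<open>\<bar>x + y\<bar>^(p^s) = \<bar>x^(p^s) + y^(p^s)\<bar> \<le> 2 M^(p^s)\<close> with \<open>M\<close> the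
  maximum; taking roots removes the factor \<open>2\<close> as \<open>s\<close> grows.
\<close>

lemma ultrametric:
  fixes x y :: 'a
  shows "absval (x + y) \<le> max (absval x) (absval y)"
proof (rule ccontr)
  define M where "M = max (absval x) (absval y)"
  assume "\<not> ?thesis"
  then have M: "M < absval (x + y)"
    unfolding M_def by linarith
  have p: "prime CHAR('a)"
    using char_pos by (rule prime_CHAR_semidom)
  have M0: "0 < M"
  proof (rule ccontr)
    assume "\<not> 0 < M"
    then have "x = 0" "y = 0"
      unfolding M_def
      by (metis absval_eq_0_iff absval_nonneg less_max_iff_disj order_le_less)+
    with M show False
      by (simp add: M_def)
  qed
  define q where "q = absval (x + y) / M"
  have "1 < q"
    using M M0 by (simp add: q_def)
  have bound: "q ^ (CHAR('a) ^ s) \<le> 2" for s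
  proof -
    let ?N = "CHAR('a) ^ s"
    have "absval (x + y) ^ ?N = absval (x ^ ?N + y ^ ?N)"
      using freshmans_dream'[OF p refl, of x y s] by (simp flip: absval_power)
    also have "\<dots> \<le> absval x ^ ?N + absval y ^ ?N"
      using abs_value_field_axioms(3)[of "x ^ ?N" "y ^ ?N"] by simp
    also have "\<dots> \<le> M ^ ?N + M ^ ?N"
      by (intro add_mono power_mono) (auto simp: M_def)
    finally show ?thesis
      using M0 by (simp add: q_def power_divide field_simps)
  qed
  obtain n where n: "2 < q ^ n"
    using real_arch_pow[OF \<open>1 < q\<close>] by blast
  have "n \<le> CHAR('a) ^ n"
    using prime_gt_1_nat[OF p] by (simp add: less_imp_le_nat power_gt_expt)
  then have "q ^ n \<le> q ^ (CHAR('a) ^ n)"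
    using \<open>1 < q\<close> by (intro power_increasing) auto
  with n bound[of n] show False
    by simp
qed

lemma ultrametric_diff:
  fixes x y :: 'a
  shows "absval (x - y) \<le> max (absval x) (absval y)"
  using ultrametric[of x "- y"] by simp

lemma absval_add_le:
  fixes x y :: 'a
  shows "absval x \<le> B \<Longrightarrow> absval y \<le> B \<Longrightarrow> absval (x + y) \<le> B"
  using ultrametric[of x y] by linarith

lemma absval_add_less:
  fixes x y :: 'a
  shows "absval x < B \<Longrightarrow> absval y < B \<Longrightarrow> absval (x + y) < B"
  using ultrametric[of x y] by linarith

lemma absval_diff_le:
  fixes x y :: 'a
  shows "absval x \<le> B \<Longrightarrow> absval y \<le> B \<Longrightarrow> absval (x - y) \<le> B"
  using ultrametric_diff[of x y] by linarith

lemma absval_diff_less: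
  fixes x y :: 'a
  shows "absval x < B \<Longrightarrow> absval y < B \<Longrightarrow> absval (x - y) < B"
  using ultrametric_diff[of x y] by linarith

text \<open>
  There is no cancellation against a strictly dominant summand. All exact values of absolute values
  below come from this.
\<close>

lemma absval_add_dominant:
  fixes x y :: 'a
  assumes "absval y < absval x"
  shows "absval (x + y) = absval x"
  using ultrametric[of x y] ultrametric_diff[of "x + y" y] assms by simp

lemma absval_sum_le:
  fixes f :: "'b \<Rightarrow> 'a"
  assumes "\<And>i. i \<in> A \<Longrightarrow> absval (f i) \<le> B" "0 \<le> B"
  shows "absval (sum f A) \<le> B"
  using assms by (induction A rule: infinite_finite_induct) (auto intro: absval_add_le)

lemma absval_sum_less:
  fixes f :: "'b \<Rightarrow> 'a"
  assumes "\<And>i. i \<in> A \<Longrightarrow> absval (f i) < B" "0 < B"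
  shows "absval (sum f A) < B"
  using assms by (induction A rule: infinite_finite_induct) (auto intro: absval_add_less)

lemma absval_of_nat_le: "absval (of_nat n :: 'a) \<le> 1"
  by (induction n) (auto intro: absval_add_le)

text \<open>
  An inverse of \<open>n\<close> modulo the characteristic gives two factors of absolute value at most \<open>1\<close>
  whose product is \<open>1\<close>.
\<close>

lemma absval_of_nat_eq_1:
  assumes "\<not> CHAR('a) dvd n"
  shows "absval (of_nat n :: 'a) = 1"
proof -
  have p: "prime CHAR('a)"
    using char_pos by (rule prime_CHAR_semidom)
  have "coprime n CHAR('a)"
    using prime_imp_coprime[OF p assms] by (simp add: coprime_commute)
  moreover have "n \<noteq> 0"
    using assms by (metis dvd_0_right)
  ultimately obtain u v where "n * u = CHAR('a) * v + 1"
    using coprime_bezout_strong[of n "CHAR('a)"] prime_gt_1_nat[OF p] by (metis less_irrefl)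
  then have "of_nat n * of_nat u = (1 :: 'a)"
    by (metis of_nat_add of_nat_CHAR of_nat_mult mult_zero_left add_0 of_nat_1)
  then have "absval (of_nat n :: 'a) * absval (of_nat u :: 'a) = 1"
    by (simp flip: absval_mult)
  with absval_of_nat_le[of n] absval_of_nat_le[of u] show ?thesis
    by (smt (verit) absval_nonneg mult_left_le)
qed

end

section \<open>Gauss norms and evaluation of power series\<close>

text \<open>
  \<open>C\<close> bounds the Gauss norm of \<open>h\<close> on the disc of radius \<open>r\<close>. The case \<open>C = r\<close>
  says that the values of \<open>h\<close> on that disc stay in it.
\<close>

definition gauss_bound :: "real \<Rightarrow> real \<Rightarrow> 'a::abs_value_field fps \<Rightarrow> bool"
  where "gauss_bound r C h \<longleftrightarrow> (\<forall>n. absval (h $ n) * r ^ n \<le> C)"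

text \<open>
  \<open>A\<close> is the Gauss norm, and \<open>N\<close> the Weierstrass degree, of \<open>h\<close> on the closed disc of
  radius \<open>r\<close>.
\<close>

definition gauss_degree :: "real \<Rightarrow> real \<Rightarrow> nat \<Rightarrow> 'a::abs_value_field fps \<Rightarrow> bool"
  where "gauss_degree r A N h \<longleftrightarrow> gauss_bound r A h \<and> absval (h $ N) * r ^ N = A \<and>
    (\<forall>n>N. absval (h $ n) * r ^ n < A)"

lemma gauss_bound_nonneg: "gauss_bound r C h \<Longrightarrow> 0 \<le> C"
  unfolding gauss_bound_def by (metis absval_nonneg mult_1_right order_trans power_0)

lemma gauss_bound_shrink:
  assumes "gauss_bound r r h" "h $ 0 = 0" "0 < s" "s \<le> r"
  shows "gauss_bound s s h"
  unfolding gauss_bound_def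
proof
  fix n
  show "absval (h $ n) * s ^ n \<le> s"
  proof (cases n)
    case 0
    then show ?thesis using assms by simp
  next
    case (Suc m)
    have "absval (h $ n) * r ^ m * r \<le> 1 * r"
      using assms(1) by (auto simp: gauss_bound_def Suc mult_ac dest: spec[of _ n])
    then have "absval (h $ n) * r ^ m \<le> 1"
      using assms by (simp add: mult_le_cancel_right)
    moreover have "absval (h $ n) * s ^ m \<le> absval (h $ n) * r ^ m"
      using assms by (intro mult_left_mono power_mono) auto
    ultimately have "absval (h $ n) * s ^ m * s \<le> 1 * s"
      using assms by (intro mult_right_mono) auto
    then show ?thesis by (simp add: Suc mult_ac)
  qed
qed

lemma gauss_bound_nth_le:
  assumes "gauss_bound r C h" "0 < r" "0 \<le> t"
  shows "absval (h $ n) * t ^ n \<le> C * (t / r) ^ n"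
proof -
  have "absval (h $ n) * t ^ n = absval (h $ n) * r ^ n * (t / r) ^ n"
    using assms by (simp add: power_divide)
  also have "\<dots> \<le> C * (t / r) ^ n"
    using assms by (intro mult_right_mono) (auto simp: gauss_bound_def)
  finally show ?thesis .
qed

context
  assumes char_pos: "CHAR('a::abs_value_field) > 0"
begin

lemma gauss_bound_mult:
  fixes u v :: "'a fps"
  assumes "gauss_bound r A u" "gauss_bound r B v" "0 < r"
  shows "gauss_bound r (A * B) (u * v)"
  unfolding gauss_bound_def
proof
  fix n
  have "absval (u $ i * v $ (n - i)) * r ^ n \<le> A * B" if "i \<le> n" for i
  proof -
    have "absval (u $ i * v $ (n - i)) * r ^ n = (absval (u $ i) * r ^ i) * (absval (v $ (n - i)) * r ^ (n - i))"
      using that by (simp add: absval_mult mult_ac flip: power_add)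
    also have "\<dots> \<le> A * B"
      using assms gauss_bound_nonneg[OF assms(1)] by (intro mult_mono) (auto simp: gauss_bound_def)
    finally show ?thesis .
  qed
  then have "absval ((u * v) $ n) \<le> A * B / r ^ n"
    unfolding fps_mult_nth
    using \<open>0 < r\<close> gauss_bound_nonneg[OF assms(1)] gauss_bound_nonneg[OF assms(2)]
    by (intro absval_sum_le[OF char_pos]) (auto simp: pos_le_divide_eq)
  then show "absval ((u * v) $ n) * r ^ n \<le> A * B"
    using \<open>0 < r\<close> by (simp add: pos_le_divide_eq)
qed

lemma gauss_bound_power:
  fixes u :: "'a fps"
  assumes "gauss_bound r A u" "0 < r"
  shows "gauss_bound r (A ^ j) (u ^ j)"
proof (induction j)
  case 0
  show ?case by (simp add: gauss_bound_def fps_one_nth)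
next
  case (Suc j)
  then show ?case using gauss_bound_mult[OF assms(1) Suc.IH assms(2)] by simp
qed

text \<open>
  Compositions and the recursions for the conjugacy and for the inverse series are all sums of such
  terms, so their coefficients are estimated one term at a time.
\<close>

lemma gauss_bound_coeff_mult_power:
  fixes u :: "'a fps"
  assumes "gauss_bound r s u" "absval c * s ^ j \<le> C" "0 < r"
  shows "absval (c * (u ^ j) $ n) * r ^ n \<le> C"
proof -
  have "absval (c * (u ^ j) $ n) * r ^ n = absval c * (absval ((u ^ j) $ n) * r ^ n)"
    by (simp add: absval_mult)
  also have "\<dots> \<le> absval c * s ^ j"
    using gauss_bound_power[OF assms(1,3), of j] by (intro mult_left_mono) (auto simp: gauss_bound_def)
  finally show ?thesis
    using assms by simp
qed

lemma gauss_bound_compose: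
  fixes u v :: "'a fps"
  assumes "gauss_bound s C v" "gauss_bound r s u" "0 < r"
  shows "gauss_bound r C (v oo u)"
  unfolding gauss_bound_def
proof
  fix n
  have "absval (v $ j * (u ^ j) $ n) \<le> C / r ^ n" for j
    using gauss_bound_coeff_mult_power[OF assms(2), of "v $ j" j C n] assms
    by (simp add: gauss_bound_def pos_le_divide_eq)
  then have "absval ((v oo u) $ n) \<le> C / r ^ n"
    unfolding fps_compose_nth using assms gauss_bound_nonneg[OF assms(1)]
    by (intro absval_sum_le[OF char_pos]) auto
  then show "absval ((v oo u) $ n) * r ^ n \<le> C"
    using assms by (simp add: pos_le_divide_eq)
qed

text \<open>
  Among the products \<open>u $ i * v $ j\<close> with \<open>i + j = N + M\<close> only the one with \<open>i = N\<close> has full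
  size, so nothing can cancel it; beyond \<open>N + M\<close> none has.
\<close>

lemma gauss_degree_mult:
  fixes u v :: "'a fps"
  assumes u: "gauss_degree r A N u" and v: "gauss_degree r B M v" and pos: "0 < r" "0 < A" "0 < B"
  shows "gauss_degree r (A * B) (N + M) (u * v)"
proof -
  have bounds: "absval (u $ i) * r ^ i \<le> A" "absval (v $ i) * r ^ i \<le> B"
    and strict: "N < i \<Longrightarrow> absval (u $ i) * r ^ i < A" "M < i \<Longrightarrow> absval (v $ i) * r ^ i < B" for i
    using u v by (auto simp: gauss_degree_def gauss_bound_def)
  have split: "absval (u $ i * v $ (n - i)) * r ^ n = (absval (u $ i) * r ^ i) * (absval (v $ (n - i)) * r ^ (n - i))"
    if "i \<le> n" for i n
    using that by (simp add: absval_mult mult_ac flip: power_add)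
  have prod_less: "s * t < S * T" if "0 \<le> s" "s < S" "t \<le> T" "0 < T" for s t S T :: real
    using mult_left_mono[OF that(3,1)] mult_strict_right_mono[OF that(2,4)] by linarith
  have less: "absval (u $ i * v $ (n - i)) < A * B / r ^ n" if "i \<le> n" "N < i \<or> M < n - i" for i n
  proof -
    have "(absval (u $ i) * r ^ i) * (absval (v $ (n - i)) * r ^ (n - i)) < A * B"
      using that(2)
    proof
      assume "N < i"
      then show ?thesis
        using strict(1)[of i] bounds(2)[of "n - i"] pos by (intro prod_less) auto
    next
      assume "M < n - i"
      then show ?thesis
        using prod_less[of "absval (v $ (n - i)) * r ^ (n - i)" B "absval (u $ i) * r ^ i" A]
          strict(2)[of "n - i"] bounds(1)[of i] pos
        by (simp add: mult.commute)
    qed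
    then show ?thesis
      using split[OF that(1)] pos by (simp add: pos_less_divide_eq)
  qed
  have "absval ((u * v) $ n) * r ^ n < A * B" if "N + M < n" for n
  proof -
    have "absval ((u * v) $ n) < A * B / r ^ n"
      unfolding fps_mult_nth using that pos
      by (intro absval_sum_less[OF char_pos] less) auto
    then show ?thesis
      using pos by (simp add: pos_less_divide_eq)
  qed
  moreover have "absval ((u * v) $ (N + M)) * r ^ (N + M) = A * B"
  proof -
    let ?t = "\<lambda>i. u $ i * v $ (N + M - i)"
    have "(u * v) $ (N + M) = ?t N + sum ?t ({0..N + M} - {N})"
      unfolding fps_mult_nth by (rule sum.remove) auto
    moreover have "absval (?t N) * r ^ (N + M) = A * B"
      using split[of N "N + M"] u v by (simp add: gauss_degree_def)
    moreover have "absval (sum ?t ({0..N + M} - {N})) < A * B / r ^ (N + M)"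
      using pos by (intro absval_sum_less[OF char_pos] less) auto
    moreover have "absval (?t N) = A * B / r ^ (N + M)"
      using calculation(2) pos by (simp add: field_simps)
    ultimately have "absval ((u * v) $ (N + M)) = absval (?t N)"
      using absval_add_dominant[OF char_pos] by simp
    with \<open>absval (?t N) * r ^ (N + M) = A * B\<close> show ?thesis
      by simp
  qed
  ultimately show ?thesis
    using gauss_bound_mult[of r A u B v] u v pos by (simp add: gauss_degree_def)
qed

lemma gauss_degree_power:
  fixes u :: "'a fps"
  assumes "gauss_degree r A N u" "0 < r" "0 < A"
  shows "gauss_degree r (A ^ j) (j * N) (u ^ j)"
proof (induction j)
  case 0
  show ?case by (simp add: gauss_degree_def gauss_bound_def fps_one_nth)
next
  case (Suc j)
  then show ?case using gauss_degree_mult[OF assms(1) Suc.IH] assms by simp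
qed

end

lemma absval_suminf_le:
  fixes f :: "nat \<Rightarrow> 'a::abs_value_field"
  assumes "CHAR('a) > 0" "summable f" "\<And>n. absval (f n) \<le> B"
  shows "absval (suminf f) \<le> B"
proof -
  have "0 \<le> B"
    using assms(3)[of 0] absval_nonneg[of "f 0"] by linarith
  then have "(\<Sum>i<n. f i) \<in> {x. absval x \<le> B}" for n
    using absval_sum_le[OF assms(1), of "{..<n}" f B] assms(3) by simp
  then have "suminf f \<in> {x. absval x \<le> B}"
    by (intro closed_sequentially[OF closed_absval_le _ summable_LIMSEQ[OF assms(2)]])
  then show ?thesis by simp
qed

lemma fps_value_LIMSEQ:
  "fps_converges h x \<Longrightarrow> (\<lambda>n. \<Sum>i<n. h $ i * x ^ i) \<longlonglongrightarrow> fps_value h x"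
  unfolding fps_value_def fps_converges_def by (rule summable_LIMSEQ)

lemma fps_value_eqI:
  "(\<lambda>n. \<Sum>i<n. h $ i * x ^ i) \<longlonglongrightarrow> y \<Longrightarrow> fps_value h x = y"
  unfolding fps_value_def by (metis sums_def sums_unique)

lemma fps_value_at_0 [simp]: "fps_value h 0 = h $ 0" "fps_converges h 0"
proof -
  have "(\<lambda>n. h $ n * 0 ^ n) sums (h $ 0)"
    using sums_If_finite_set[of "{0}" "\<lambda>n. h $ n * 0 ^ n"]
    by (simp add: power_0_left if_distrib cong: if_cong)
  then show "fps_value h 0 = h $ 0" "fps_converges h 0"
    unfolding fps_value_def fps_converges_def by (auto simp: sums_iff)
qed

lemma fps_value_const_mult:
  assumes "fps_converges h x"
  shows "fps_value (fps_const c * h) x = c * fps_value h x"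
proof (rule fps_value_eqI)
  show "(\<lambda>n. \<Sum>i<n. (fps_const c * h) $ i * x ^ i) \<longlonglongrightarrow> c * fps_value h x"
    using tendsto_mult[OF tendsto_const fps_value_LIMSEQ[OF assms], of c]
    by (simp add: sum_distrib_left mult.assoc)
qed

lemma fps_value_add:
  assumes "fps_converges u x" "fps_converges v x"
  shows "fps_value (u + v) x = fps_value u x + fps_value v x"
proof (rule fps_value_eqI)
  show "(\<lambda>n. \<Sum>i<n. (u + v) $ i * x ^ i) \<longlonglongrightarrow> fps_value u x + fps_value v x"
    using tendsto_add[OF assms[THEN fps_value_LIMSEQ]]
    by (simp add: ring_distribs sum.distrib)
qed

lemma fps_value_X: "fps_value fps_X x = x"
proof (rule fps_value_eqI)
  have "(\<Sum>i<n. fps_X $ i * x ^ i) = x" if "2 \<le> n" for n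
    using that by (simp add: if_distrib[of "\<lambda>c. c * _"] sum.If_cases mult_delta_left)
  then show "(\<lambda>n. \<Sum>i<n. fps_X $ i * x ^ i) \<longlonglongrightarrow> x"
    by (intro tendsto_eventually eventually_sequentiallyI[of 2])
qed

context
  assumes char_pos: "CHAR('a::{abs_value_field, complete_space}) > 0"
begin

lemma ultrametric_summable:
  fixes f :: "nat \<Rightarrow> 'a"
  assumes "(\<lambda>n. absval (f n)) \<longlonglongrightarrow> 0"
  shows "summable f"
proof -
  have "Cauchy (\<lambda>n. \<Sum>i<n. f i)"
  proof (rule metric_CauchyI)
    fix e :: real
    assume "0 < e"
    then have "eventually (\<lambda>n. absval (f n) < e) sequentially"
      using order_tendstoD(2)[OF assms] by blast
    then obtain M where M: "\<And>n. M \<le> n \<Longrightarrow> absval (f n) < e"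
      by (auto simp: eventually_sequentially)
    have le: "dist (\<Sum>i<n. f i) (\<Sum>i<n'. f i) < e" if "M \<le> n'" "n' \<le> n" for n n'
    proof -
      have "(\<Sum>i<n. f i) - (\<Sum>i<n'. f i) = sum f ({..<n} - {..<n'})"
        using that by (intro sum_diff[symmetric]) auto
      then show ?thesis
        using that \<open>0 < e\<close> M by (auto simp: dist_absval intro!: absval_sum_less[OF char_pos])
    qed
    have "dist (\<Sum>i<n. f i) (\<Sum>i<n'. f i) < e" if "M \<le> n" "M \<le> n'" for n n'
      using le[of n' n] le[of n n'] that by (metis dist_commute linorder_le_cases)
    then show "\<exists>M. \<forall>m\<ge>M. \<forall>n\<ge>M. dist (\<Sum>i<m. f i) (\<Sum>i<n. f i) < e"
      by blast
  qed
  then show ?thesis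
    by (simp add: summable_iff_convergent Cauchy_convergent)
qed

lemma fps_convergesI:
  fixes h :: "'a fps"
  assumes "gauss_bound r C h" "absval x < r"
  shows "fps_converges h x"
  unfolding fps_converges_def
proof (rule ultrametric_summable)
  have r: "0 < r"
    using assms absval_nonneg[of x] by linarith
  have "(\<lambda>n. C * (absval x / r) ^ n) \<longlonglongrightarrow> C * 0"
    using assms r by (intro tendsto_intros LIMSEQ_power_zero) auto
  then have lim: "(\<lambda>n. C * (absval x / r) ^ n) \<longlonglongrightarrow> 0"
    by simp
  show "(\<lambda>n. absval (h $ n * x ^ n)) \<longlonglongrightarrow> 0"
    by (rule tendsto_sandwich[OF _ _ tendsto_const lim])
      (use gauss_bound_nth_le[OF assms(1) r] in \<open>auto simp: absval_mult\<close>)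
qed

lemma fps_value_le:
  fixes h :: "'a fps"
  assumes "fps_converges h x" "\<And>n. absval (h $ n) * absval x ^ n \<le> B"
  shows "absval (fps_value h x) \<le> B"
  unfolding fps_value_def
  using assms by (intro absval_suminf_le[OF char_pos]) (auto simp: fps_converges_def absval_mult)

text \<open>
  The product of the partial sums differs from the partial sum of the product only by terms of
  total degree at least \<open>n\<close>, which tend to \<open>0\<close> uniformly because \<open>\<bar>x\<bar> < r\<close>.
\<close>

lemma fps_value_mult:
  fixes u v :: "'a fps"
  assumes u: "gauss_bound r A u" and v: "gauss_bound r B v" and x: "absval x < r"
  shows "fps_value (u * v) x = fps_value u x * fps_value v x"
proof (rule fps_value_eqI)
  let ?S = "\<lambda>h n. \<Sum>i<n. h $ i * x ^ i"
  define q where "q = absval x / r"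
  have r: "0 < r"
    using x absval_nonneg[of x] by linarith
  have q: "0 \<le> q" "q < 1"
    using r x by (auto simp: q_def)
  have AB: "0 \<le> A" "0 \<le> B"
    using gauss_bound_nonneg[OF u] gauss_bound_nonneg[OF v] by auto
  have "absval (?S (u * v) n - ?S u n * ?S v n) \<le> A * B * q ^ n" for n
  proof -
    let ?t = "\<lambda>(i, j). (u $ i * x ^ i) * (v $ j * x ^ j)"
    have "?S (u * v) n = (\<Sum>l<n. \<Sum>i\<le>l. (u $ i * x ^ i) * (v $ (l - i) * x ^ (l - i)))"
      unfolding fps_mult_nth sum_distrib_right atLeast0AtMost
    proof (intro sum.cong refl)
      fix l i :: nat
      assume "i \<in> {..l}"
      then have "x ^ l = x ^ i * x ^ (l - i)"
        by (simp flip: power_add)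
      then show "u $ i * v $ (l - i) * x ^ l = u $ i * x ^ i * (v $ (l - i) * x ^ (l - i))"
        by (simp add: mult_ac)
    qed
    also have "\<dots> = sum ?t {(i, j). i + j < n}"
      by (rule sum.triangle_reindex[symmetric])
    finally have 1: "?S (u * v) n = sum ?t {(i, j). i + j < n}" .
    have 2: "?S u n * ?S v n = sum ?t ({..<n} \<times> {..<n})"
      by (simp add: sum_product sum.cartesian_product)
    have "?S u n * ?S v n - ?S (u * v) n = sum ?t ({..<n} \<times> {..<n} - {(i, j). i + j < n})"
      unfolding 1 2 by (rule sum_diff[symmetric]) auto
    also have "absval \<dots> \<le> A * B * q ^ n"
    proof (rule absval_sum_le[OF char_pos])
      fix z
      assume "z \<in> {..<n} \<times> {..<n} - {(i, j). i + j < n}"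
      then obtain i j where z: "z = (i, j)" "n \<le> i + j"
        by auto
      have "absval (?t z) = (absval (u $ i) * absval x ^ i) * (absval (v $ j) * absval x ^ j)"
        by (simp add: z absval_mult)
      also have "\<dots> \<le> (A * q ^ i) * (B * q ^ j)"
        unfolding q_def using AB r
        by (intro mult_mono gauss_bound_nth_le[OF u] gauss_bound_nth_le[OF v]) auto
      also have "\<dots> = A * B * q ^ (i + j)"
        by (simp add: power_add)
      also have "\<dots> \<le> A * B * q ^ n"
        using z q AB by (intro mult_left_mono power_decreasing) auto
      finally show "absval (?t z) \<le> A * B * q ^ n" .
    qed (use AB q in auto)
    finally show ?thesis
      by (simp add: absval_diff_commute)
  qed
  moreover have "(\<lambda>n. A * B * q ^ n) \<longlonglongrightarrow> A * B * 0"
    using q by (intro tendsto_intros LIMSEQ_power_zero) auto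
  ultimately have "(\<lambda>n. ?S (u * v) n - ?S u n * ?S v n) \<longlonglongrightarrow> 0"
    by (intro tendsto_absval_le[where g = "\<lambda>n. A * B * q ^ n"]) auto
  then have "(\<lambda>n. (?S (u * v) n - ?S u n * ?S v n) + ?S u n * ?S v n) \<longlonglongrightarrow> 0 + fps_value u x * fps_value v x"
    by (intro tendsto_add tendsto_mult fps_value_LIMSEQ fps_convergesI[OF u x] fps_convergesI[OF v x])
  then show "?S (u * v) \<longlonglongrightarrow> fps_value u x * fps_value v x"
    by simp
qed

lemma fps_value_power:
  fixes u :: "'a fps"
  assumes u: "gauss_bound r A u" and x: "absval x < r"
  shows "fps_value (u ^ j) x = fps_value u x ^ j"
proof (induction j)
  case 0
  have "(\<Sum>i<n. (1 :: 'a fps) $ i * x ^ i) = 1" if "0 < n" for n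
    using that by (simp add: fps_one_nth mult_delta_left)
  then show ?case
    by (auto intro!: fps_value_eqI tendsto_eventually eventually_sequentiallyI[of 1])
next
  case (Suc j)
  have "0 < r"
    using x absval_nonneg[of x] by linarith
  then show ?case
    using fps_value_mult[OF u gauss_bound_power[OF char_pos u] x] Suc by simp
qed

text \<open>
  Truncating \<open>v\<close> at degree \<open>N\<close> turns the claim into finitely many applications of the
  product rule, and changes \<open>v oo u\<close> only in degrees at least \<open>N\<close>, since \<open>u\<close> has no constant term. All
  coefficients involved have Gauss norm at most \<open>C\<close>, so the value changes by at most \<open>C q^N\<close>
  with \<open>q = \<bar>x\<bar> / r < 1\<close>.
\<close>

lemma fps_value_compose:
  fixes u v :: "'a fps"
  assumes v: "gauss_bound s C v" and u: "gauss_bound r s u" and u0: "u $ 0 = 0"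
    and s: "0 < s" and x: "absval x < r"
  shows "absval (fps_value u x) < s" and "fps_value (v oo u) x = fps_value v (fps_value u x)"
proof -
  define q where "q = absval x / r"
  have r: "0 < r"
    using x absval_nonneg[of x] by linarith
  have q: "0 \<le> q" "q < 1"
    using r x by (auto simp: q_def)
  have "absval (fps_value u x) \<le> s * q"
  proof (rule fps_value_le[OF fps_convergesI[OF u x]])
    fix n
    show "absval (u $ n) * absval x ^ n \<le> s * q"
    proof (cases "n = 0")
      case False
      have "absval (u $ n) * absval x ^ n \<le> s * q ^ n"
        unfolding q_def by (intro gauss_bound_nth_le[OF u r]) auto
      also have "\<dots> \<le> s * q ^ 1"
        using s q False by (intro mult_left_mono power_decreasing) auto
      finally show ?thesis by simp
    qed (use u0 s q in simp)
  qed
  also have "\<dots> < s"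
    using s q by simp
  finally show w: "absval (fps_value u x) < s" .
  let ?w = "fps_value u x"
  define G where "G = (\<lambda>N. \<Sum>j<N. fps_const (v $ j) * u ^ j)"
  have C: "0 \<le> C"
    using gauss_bound_nonneg[OF v] .
  have Gb: "gauss_bound r C (fps_const (v $ j) * u ^ j)" for j
    using gauss_bound_coeff_mult_power[OF char_pos u, of "v $ j" j C] v r
    by (simp add: gauss_bound_def)
  have conv: "fps_converges (u ^ j) x" for j
    using gauss_bound_power[OF char_pos u] r x fps_convergesI[of r "s ^ j"] by simp
  have value_G: "gauss_bound r C (G N) \<and> fps_value (G N) x = (\<Sum>j<N. v $ j * ?w ^ j)" for N
  proof (induction N)
    case 0
    have "fps_value (0 :: 'a fps) x = 0"
      by (rule fps_value_eqI) simp
    then show ?case by (simp add: G_def gauss_bound_def C)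
  next
    case (Suc N)
    have GS: "G (Suc N) = G N + fps_const (v $ N) * u ^ N"
      by (simp add: G_def)
    have "gauss_bound r C (G (Suc N))"
      unfolding gauss_bound_def
    proof
      fix n
      have "absval (G (Suc N) $ n) \<le> C / r ^ n"
        unfolding GS fps_add_nth using Suc Gb[of N] r
        by (intro absval_add_le[OF char_pos]) (auto simp: gauss_bound_def pos_le_divide_eq)
      then show "absval (G (Suc N) $ n) * r ^ n \<le> C"
        using r by (simp add: pos_le_divide_eq)
    qed
    moreover have "fps_value (G (Suc N)) x = fps_value (G N) x + v $ N * ?w ^ N"
      unfolding GS using Suc
      by (subst fps_value_add)
        (auto simp: fps_value_const_mult[OF conv] fps_value_power[OF u x]
          intro!: fps_convergesI[OF _ x] Gb)
    ultimately show ?case using Suc by simp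
  qed
  have comp: "gauss_bound r C (v oo u)"
    by (rule gauss_bound_compose[OF char_pos v u r])
  have diff: "absval (fps_value (v oo u) x - (\<Sum>j<N. v $ j * ?w ^ j)) \<le> C * q ^ N" for N
  proof -
    define d where "d = (v oo u) + fps_const (-1) * G N"
    have d_nth: "d $ n = (v oo u) $ n - G N $ n" for n
      by (simp add: d_def)
    have "gauss_bound r C d"
      unfolding gauss_bound_def
    proof
      fix n
      have "absval (d $ n) \<le> C / r ^ n"
        unfolding d_nth using value_G[of N] comp r
        by (intro absval_diff_le[OF char_pos]) (auto simp: gauss_bound_def pos_le_divide_eq)
      then show "absval (d $ n) * r ^ n \<le> C"
        using r by (simp add: pos_le_divide_eq)
    qed
    have small: "d $ n = 0" if "n < N" for n
    proof -
      have "G N $ n = (\<Sum>j<N. v $ j * (u ^ j) $ n)"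
        by (simp add: G_def fps_sum_nth)
      also have "\<dots> = (\<Sum>j\<in>{0..n}. v $ j * (u ^ j) $ n)"
        using that startsby_zero_power_prefix[OF u0]
        by (intro sum.mono_neutral_right) auto
      finally show ?thesis
        by (simp add: d_nth fps_compose_nth)
    qed
    have "absval (fps_value d x) \<le> C * q ^ N"
    proof (rule fps_value_le[OF fps_convergesI[OF \<open>gauss_bound r C d\<close> x]])
      fix n
      show "absval (d $ n) * absval x ^ n \<le> C * q ^ N"
      proof (cases "n < N")
        case False
        have "absval (d $ n) * absval x ^ n \<le> C * q ^ n"
          unfolding q_def by (intro gauss_bound_nth_le[OF \<open>gauss_bound r C d\<close> r]) auto
        also have "\<dots> \<le> C * q ^ N"
          using C q False by (intro mult_left_mono power_decreasing) auto
        finally show ?thesis by simp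
      qed (use small C q in simp)
    qed
    moreover have cG: "fps_converges (G N) x"
      using value_G[of N] fps_convergesI[OF _ x] by blast
    moreover have "gauss_bound r C (fps_const (- 1) * G N)"
      using value_G[of N] by (simp add: gauss_bound_def)
    ultimately show ?thesis
      unfolding d_def using value_G[of N]
      by (simp only: fps_value_add[OF fps_convergesI[OF comp x] fps_convergesI[OF _ x]]
          fps_value_const_mult[OF cG]) simp
  qed
  have "(\<lambda>N. C * q ^ N) \<longlonglongrightarrow> C * 0"
    using q by (intro tendsto_intros LIMSEQ_power_zero) auto
  then have "(\<lambda>N. \<Sum>j<N. v $ j * ?w ^ j) \<longlonglongrightarrow> fps_value (v oo u) x"
    using diff by (intro tendsto_absval_le[where g = "\<lambda>N. C * q ^ N"])
      (auto simp: absval_diff_commute)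
  then show "fps_value (v oo u) x = fps_value v ?w"
    by (rule fps_value_eqI[symmetric])
qed

end

section \<open>Formal conjugacy\<close>

lemma fps_compose_nth_split:
  assumes "f $ 0 = (0 :: 'a::field)"
  shows "(g oo f) $ n = (\<Sum>j<n. g $ j * (f ^ j) $ n) + g $ n * (f $ 1) ^ n"
proof -
  have "{0..n} = insert n {..<n}"
    by auto
  then show ?thesis
    unfolding fps_compose_nth using startsby_zero_power_nth_same[OF assms, of n]
    by (simp add: add.commute)
qed

lemma conjugates_iff:
  assumes "f $ 0 = (0 :: 'a::field)"
  shows "g oo f = fps_const (f $ 1) * g \<longleftrightarrow>
    (\<forall>n. g $ n * (f $ 1 - (f $ 1) ^ n) = (\<Sum>j<n. g $ j * (f ^ j) $ n))"
  unfolding fps_eq_iff fps_compose_nth_split[OF assms]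
  by (auto simp: algebra_simps)

text \<open>
  The conjugacy equation solved for its highest coefficient.
\<close>

fun conjugacy_coeff :: "'a::field fps \<Rightarrow> nat \<Rightarrow> 'a" where
  "conjugacy_coeff f 0 = 0"
| "conjugacy_coeff f (Suc n) = (if n = 0 then 1 else
    (\<Sum>j\<in>{0..n}. conjugacy_coeff f j * (f ^ j) $ Suc n) / (f $ 1 - (f $ 1) ^ Suc n))"

lemma conjugacy_ex1:
  fixes f :: "'a::field fps"
  assumes f0: "f $ 0 = 0" and nz: "f $ 1 \<noteq> 0" and nr: "\<And>n. 1 \<le> n \<Longrightarrow> (f $ 1) ^ n \<noteq> 1"
  shows "\<exists>!g. g $ 0 = 0 \<and> g $ 1 = 1 \<and> g oo f = fps_const (f $ 1) * g"
proof -
  have divisor: "f $ 1 - (f $ 1) ^ Suc n \<noteq> 0" if "1 \<le> n" for n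
    using nr[OF that] nz by simp
  have small: "(\<Sum>j<Suc 0. h $ j * (f ^ j) $ Suc 0) = 0" if "h $ 0 = 0" for h :: "'a fps"
    using that by simp
  show ?thesis
  proof (rule ex_ex1I)
    let ?g = "Abs_fps (conjugacy_coeff f)"
    have "?g $ n * (f $ 1 - (f $ 1) ^ n) = (\<Sum>j<n. ?g $ j * (f ^ j) $ n)" for n
    proof (cases n)
      case (Suc i)
      show ?thesis
      proof (cases "i = 0")
        case False
        then show ?thesis
          using divisor[of i] by (simp add: Suc lessThan_Suc_atMost atLeast0AtMost del: power_Suc)
      qed (use Suc in simp)
    qed simp
    then have "?g oo f = fps_const (f $ 1) * ?g"
      unfolding conjugates_iff[OF f0] by blast
    then show "\<exists>g. g $ 0 = 0 \<and> g $ 1 = 1 \<and> g oo f = fps_const (f $ 1) * g"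
      by (intro exI[of _ ?g]) simp
  next
    fix g h
    assume gh: "g $ 0 = 0 \<and> g $ 1 = 1 \<and> g oo f = fps_const (f $ 1) * g"
      "h $ 0 = 0 \<and> h $ 1 = 1 \<and> h oo f = fps_const (f $ 1) * h"
    have "g $ n = h $ n" for n
    proof (induction n rule: less_induct)
      case (less n)
      consider "n = 0" | "n = 1" | "2 \<le> n"
        by linarith
      then show ?case
      proof cases
        case 3
        have "g $ n * (f $ 1 - (f $ 1) ^ n) = (\<Sum>j<n. g $ j * (f ^ j) $ n)"
          "h $ n * (f $ 1 - (f $ 1) ^ n) = (\<Sum>j<n. h $ j * (f ^ j) $ n)"
          using gh conjugates_iff[OF f0] by blast+
        then have "g $ n * (f $ 1 - (f $ 1) ^ n) = h $ n * (f $ 1 - (f $ 1) ^ n)"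
          using less.IH by simp
        then show ?thesis
          using divisor[of "n - 1"] 3 by simp
      qed (use gh in auto)
    qed
    then show "g = h"
      by (simp add: fps_eq_iff)
  qed
qed

lemma conjugacy_properties:
  fixes f :: "'a::field fps"
  assumes "f $ 0 = 0" "f $ 1 \<noteq> 0" "\<And>n. 1 \<le> n \<Longrightarrow> (f $ 1) ^ n \<noteq> 1"
  shows "conjugacy f $ 0 = 0" "conjugacy f $ 1 = 1"
    "conjugacy f oo f = fps_const (f $ 1) * conjugacy f"
  using theI'[OF conjugacy_ex1[OF assms]] unfolding conjugacy_def by auto

text \<open>
  The lowest nonconstant coefficient \<open>u $ n\<close> would satisfy \<open>u $ n = u $ n * (f $ 1) ^ n\<close>.
\<close>

lemma invariant_series_const:
  fixes f u :: "'a::field fps"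
  assumes f0: "f $ 0 = 0" and nr: "\<And>n. 1 \<le> n \<Longrightarrow> (f $ 1) ^ n \<noteq> 1" and inv: "u oo f = u"
    and "1 \<le> n"
  shows "u $ n = 0"
  using \<open>1 \<le> n\<close>
proof (induction n rule: less_induct)
  case (less n)
  have "u $ j * (f ^ j) $ n = 0" if "j < n" for j
    using that less by (cases "j = 0") (auto simp: fps_one_nth)
  then have "(\<Sum>j<n. u $ j * (f ^ j) $ n) = 0"
    by (intro sum.neutral) auto
  then have "u $ n = u $ n * (f $ 1) ^ n"
    using fps_compose_nth_split[OF f0, of u n] inv by simp
  then show ?case
    using nr[OF less.prems] by simp
qed

text \<open>
  The hypothesis on the exponents says \<open>f' = f $ 1\<close>. The chain rule then makes \<open>g'\<close> invariant
  under \<open>f\<close>, hence constant. In characteristic \<open>p\<close> the conclusion means that \<open>g\<close>, too, has beyond its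
  linear term only exponents divisible by \<open>p\<close>.
\<close>

lemma conjugacy_exponents:
  fixes f g :: "'a::field fps"
  assumes f0: "f $ 0 = 0" and nz: "f $ 1 \<noteq> 0" and nr: "\<And>n. 1 \<le> n \<Longrightarrow> (f $ 1) ^ n \<noteq> 1"
    and exps: "\<And>i. 2 \<le> i \<Longrightarrow> of_nat i * f $ i = 0"
    and conj: "g oo f = fps_const (f $ 1) * g" and n: "2 \<le> n"
  shows "of_nat n * g $ n = 0"
proof -
  have deriv_f: "fps_deriv f = fps_const (f $ 1)"
    unfolding fps_eq_iff
  proof
    fix i
    show "fps_deriv f $ i = fps_const (f $ 1) $ i"
      using exps[of "i + 1"] by (cases "i = 0") auto
  qed
  have "(fps_deriv g oo f) * fps_const (f $ 1) = fps_const (f $ 1) * fps_deriv g"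
    using arg_cong[OF conj, of fps_deriv] by (simp add: fps_compose_deriv[OF f0] deriv_f)
  then have "fps_deriv g oo f = fps_deriv g"
    using nz by (simp add: mult.commute)
  from invariant_series_const[OF f0 nr this, of "n - 1"] n show ?thesis
    by simp
qed

lemma fps_map_nth [simp]: "fps_map \<phi> h $ n = \<phi> (h $ n)"
  by (simp add: fps_map_def)

lemma fps_map_conjugates:
  fixes \<phi> :: "'a::field \<Rightarrow> 'b::field"
  assumes add: "\<And>x y. \<phi> (x + y) = \<phi> x + \<phi> y" and mult: "\<And>x y. \<phi> (x * y) = \<phi> x * \<phi> y"
    and one: "\<phi> 1 = 1" and conj: "g oo f = fps_const c * g"
  shows "fps_map \<phi> g oo fps_map \<phi> f = fps_const (\<phi> c) * fps_map \<phi> g"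
proof -
  have zero: "\<phi> 0 = 0"
    using add[of 0 0] by (simp only: add_0_left add_cancel_right_left)
  have sum: "\<phi> (sum h A) = (\<Sum>i\<in>A. \<phi> (h i))" for h :: "nat \<Rightarrow> 'a" and A
    by (induction A rule: infinite_finite_induct) (auto simp: zero add)
  have "fps_map \<phi> (u * v) = fps_map \<phi> u * fps_map \<phi> v" for u v
    by (simp add: fps_eq_iff fps_mult_nth sum mult)
  moreover have "fps_map \<phi> 1 = 1"
    by (simp add: fps_eq_iff fps_one_nth zero one)
  ultimately have power: "fps_map \<phi> (u ^ j) = fps_map \<phi> u ^ j" for u j
    by (induction j) simp_all
  have "fps_map \<phi> (g oo f) = fps_map \<phi> g oo fps_map \<phi> f"
    by (simp add: fps_eq_iff fps_compose_nth sum mult flip: power)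
  moreover have "fps_map \<phi> (fps_const c * g) = fps_const (\<phi> c) * fps_map \<phi> g"
    by (simp add: fps_eq_iff mult)
  ultimately show ?thesis
    by (simp flip: conj)
qed

section \<open>Small divisors\<close>

context
  fixes l :: "'a::abs_value_field" and m :: nat
  assumes char_pos: "CHAR('a) > 0" and residue_torsion: "\<exists>n\<ge>1. absval (1 - l ^ n) < 1"
  defines "m \<equiv> mult_order_residue l"
begin

lemma mult_order_residue_pos: "1 \<le> m" and absval_one_minus_power_order: "absval (1 - l ^ m) < 1"
  and mult_order_residue_le: "1 \<le> n \<Longrightarrow> absval (1 - l ^ n) < 1 \<Longrightarrow> m \<le> n"
  using LeastI_ex[OF residue_torsion] Least_le[of "\<lambda>n. 1 \<le> n \<and> absval (1 - l ^ n) < 1" n]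
  by (auto simp: m_def mult_order_residue_def)

lemma absval_residue_torsion: "absval l = 1"
proof -
  have "absval (1 + - (1 - l ^ m)) = absval (1 :: 'a)"
    using absval_one_minus_power_order
    by (intro absval_add_dominant[OF char_pos]) (simp only: absval_minus absval_1)
  then have "absval l ^ m = 1"
    by simp
  then show ?thesis
    using mult_order_residue_pos power_eq_imp_eq_base[of "absval l" m 1] by simp
qed

lemma absval_one_minus_power_multiple: "absval (1 - l ^ (m * t)) < 1"
proof (induction t)
  case (Suc t)
  have "1 - l ^ (m * Suc t) = (1 - l ^ m) + l ^ m * (1 - l ^ (m * t))"
    by (simp add: algebra_simps power_add)
  then show ?case
    using Suc absval_one_minus_power_order
    by (simp only: absval_mult absval_residue_torsion absval_power power_one mult_1_left
        absval_add_less[OF char_pos])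
qed simp

text \<open>
  Multiples of \<open>m\<close> do not change the residue class of \<open>l ^ n\<close>, so \<open>n\<close> may be replaced by
  \<open>n mod m\<close>, to which the minimality of \<open>m\<close> applies.
\<close>

lemma absval_one_minus_power_eq_1:
  assumes "\<not> m dvd n"
  shows "absval (1 - l ^ n) = 1"
proof (rule ccontr)
  have "absval (1 - l ^ i) \<le> 1" for i
    by (intro absval_diff_le[OF char_pos]) (simp_all add: absval_residue_torsion)
  moreover assume "absval (1 - l ^ n) \<noteq> 1"
  ultimately have less: "absval (1 - l ^ n) < 1"
    by (simp add: less_le)
  let ?t = "n div m"
  have "l ^ n = l ^ (m * ?t) * l ^ (n mod m)"
    by (simp flip: power_add)
  then have "l ^ (m * ?t) * (1 - l ^ (n mod m)) = (1 - l ^ n) - (1 - l ^ (m * ?t))"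
    by (simp add: algebra_simps)
  then have "absval (l ^ (m * ?t) * (1 - l ^ (n mod m))) < 1"
    using less absval_one_minus_power_multiple by (simp only: absval_diff_less[OF char_pos])
  then have "absval (1 - l ^ (n mod m)) < 1"
    by (simp add: absval_mult absval_residue_torsion)
  moreover have "1 \<le> n mod m"
    using assms by (simp add: dvd_eq_mod_eq_0 Suc_le_eq)
  ultimately have "m \<le> n mod m"
    by (rule mult_order_residue_le[rotated])
  then show False
    using mult_order_residue_pos mod_less_divisor[of m n] by linarith
qed

text \<open>
  If \<open>m = p t\<close>, then \<open>(1 - l ^ t) ^ p = 1 - l ^ m\<close> shows that \<open>t\<close> already qualifies.
\<close>

lemma coprime_mult_order_residue: "coprime CHAR('a) m"
proof -
  have p: "prime CHAR('a)"
    using char_pos by (rule prime_CHAR_semidom)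
  have "\<not> CHAR('a) dvd m"
  proof
    assume "CHAR('a) dvd m"
    then obtain t where t: "m = CHAR('a) * t" ..
    have "l ^ m = (l ^ t) ^ CHAR('a)"
      unfolding t by (simp add: power_mult mult.commute flip: power_mult)
    have "((1 - l ^ t) + l ^ t) ^ CHAR('a) = (1 - l ^ t) ^ CHAR('a) + (l ^ t) ^ CHAR('a)"
      by (rule freshmans_dream[OF p refl])
    then have "1 - l ^ m = (1 - l ^ t) ^ CHAR('a)"
      using \<open>l ^ m = (l ^ t) ^ CHAR('a)\<close> by (simp add: algebra_simps)
    then have "absval (1 - l ^ t) ^ CHAR('a) < 1"
      using absval_one_minus_power_order by simp
    then have "absval (1 - l ^ t) < 1"
      by (meson linorder_not_le one_le_power)
    moreover have "1 \<le> t"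
      using t mult_order_residue_pos by (cases t) auto
    ultimately have "m \<le> t"
      by (rule mult_order_residue_le[rotated])
    moreover have "t < m"
      using t \<open>1 \<le> t\<close> prime_gt_1_nat[OF p] by simp
    ultimately show False by simp
  qed
  then show ?thesis
    by (rule prime_imp_coprime[OF p])
qed

text \<open>
  With \<open>n = m t\<close>, the quotient of the two differences is a sum of \<open>t\<close> powers of \<open>l ^ m\<close>. It is
  congruent to \<open>t\<close> modulo the maximal ideal, and \<open>t\<close> is prime to the characteristic.
\<close>

lemma absval_one_minus_power_resonant:
  assumes "m dvd n" "\<not> CHAR('a) dvd n"
  shows "absval (1 - l ^ n) = absval (1 - l ^ m)"
proof -
  obtain t where t: "n = m * t"
    using assms by blast
  have "1 - l ^ n = (1 - l ^ m) * (\<Sum>i<t. l ^ (m * i))"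
    unfolding t power_mult by (rule one_diff_power_eq)
  moreover have "(\<Sum>i<t. l ^ (m * i)) = of_nat t + - (\<Sum>i<t. 1 - l ^ (m * i))"
    by (simp add: sum_subtractf)
  moreover have "absval (of_nat t :: 'a) = 1"
    using assms t by (intro absval_of_nat_eq_1[OF char_pos]) auto
  moreover have "absval (\<Sum>i<t. 1 - l ^ (m * i)) < 1"
    by (intro absval_sum_less[OF char_pos] absval_one_minus_power_multiple) simp
  ultimately show ?thesis
    using absval_add_dominant[OF char_pos, of "- (\<Sum>i<t. 1 - l ^ (m * i))" "of_nat t"]
    by (simp only: absval_mult absval_minus)
qed

end

text \<open>
  By the Chinese remainder theorem the conditions \<open>p dvd n\<close> and \<open>m dvd n - 1\<close> describe one
  residue class modulo \<open>m * p\<close>, with representative \<open>k\<close> in \<open>{1..m * p}\<close>.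
\<close>

lemma min_resonance_properties:
  fixes l :: "'a::abs_value_field" and m p :: nat
  assumes "coprime p m" "1 < p" "1 \<le> m" "m = mult_order_residue l"
  defines "k \<equiv> min_resonance p l"
  shows "2 \<le> k" "p dvd k" "m dvd k - 1" "k \<le> m * p"
    and "\<And>n. 1 \<le> n \<Longrightarrow> p dvd n \<Longrightarrow> m dvd n - 1 \<Longrightarrow> k \<le> n \<and> m * p dvd n - k"
proof -
  let ?P = "\<lambda>k. 1 \<le> k \<and> p dvd k \<and> m dvd k - 1"
  have k: "k = Least ?P"
    by (simp add: k_def min_resonance_def assms(4))
  \<comment> \<open>\<open>s\<close> represents \<open>- 1 / m\<close> modulo \<open>p\<close>, so that \<open>m * s + 1\<close> satisfies both conditions.\<close>
  obtain x y where xy: "m * x = p * y + 1"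
    using coprime_bezout_strong[of m p] assms by (auto simp: coprime_commute)
  define s where "s = ((p - 1) * x) mod p"
  have "s < p"
    using assms by (simp add: s_def)
  have "p dvd m * ((p - 1) * x) + 1"
  proof -
    have "m * ((p - 1) * x) + 1 = (p - 1) * (m * x) + 1"
      by (simp add: mult_ac)
    also have "\<dots> = (p - 1) * (p * y) + ((p - 1) + 1)"
      unfolding xy by (simp only: distrib_left mult_1_right add.assoc)
    also have "\<dots> = p * ((p - 1) * y + 1)"
      using assms(2) by (simp add: distrib_left mult_ac)
    finally show ?thesis by simp
  qed
  moreover have "(m * s + 1) mod p = (m * ((p - 1) * x) + 1) mod p"
    unfolding s_def by (metis mod_add_left_eq mod_mult_right_eq)
  ultimately have "p dvd m * s + 1"
    by (metis dvd_eq_mod_eq_0)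
  then have ex: "?P (m * s + 1)"
    by simp
  have "m * s + 1 \<le> m * s + m"
    using assms by simp
  also have "\<dots> = m * Suc s"
    by simp
  also have "\<dots> \<le> m * p"
    using \<open>s < p\<close> by (intro mult_le_mono2) simp
  finally show "k \<le> m * p"
    unfolding k using Least_le[of ?P, OF ex] by linarith
  have Pk: "?P k"
    unfolding k by (rule LeastI[of ?P, OF ex])
  then show "p dvd k" "m dvd k - 1"
    by auto
  show "2 \<le> k"
    using Pk assms(2) by (auto dest!: dvd_imp_le)
  fix n
  assume n: "1 \<le> n" "p dvd n" "m dvd n - 1"
  then have "k \<le> n"
    unfolding k by (intro Least_le) auto
  moreover have "p dvd n - k"
    using n Pk by (simp add: dvd_diff_nat)
  moreover have "m dvd n - k"
    using dvd_diff_nat[OF n(3), of "k - 1"] Pk n by simp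
  ultimately show "k \<le> n \<and> m * p dvd n - k"
    using assms(1) by (simp add: divides_mult coprime_commute)
qed

section \<open>Growth of the conjugacy coefficients\<close>

text \<open>
  In terms of \<open>\<rho> = 1 / a\<close>, the requirement \<open>\<bar>f $ i\<bar> \<le> a ^ (i - 1)\<close> for all \<open>i\<close> becomes a Gauss bound on
  the disc of radius \<open>\<rho>\<close>, and \<open>dominant\<close> and \<open>below\<close> say that \<open>k\<close> is the first index
  \<open>i \<ge> 2\<close> at which this bound is attained.
\<close>

locale resonant_series =
  fixes f :: "'a::abs_value_field fps" and l :: 'a and p m k :: nat and \<rho> :: real
  assumes char_p: "CHAR('a) = p" and p_pos: "0 < p"
    and f0: "f $ 0 = 0" and f1: "f $ 1 = l"
    and exponents: "2 \<le> i \<Longrightarrow> \<not> p dvd i \<Longrightarrow> f $ i = 0"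
    and rho_pos: "0 < \<rho>" and bound: "gauss_bound \<rho> \<rho> f"
    and not_root: "1 \<le> n \<Longrightarrow> l ^ n \<noteq> 1"
    and residue_torsion: "\<exists>n\<ge>1. absval (1 - l ^ n) < 1"
    and m_def: "m = mult_order_residue l" and k_def: "k = min_resonance p l"
    and dominant: "absval (f $ k) * \<rho> ^ k = \<rho>"
    and below: "2 \<le> i \<Longrightarrow> i < k \<Longrightarrow> absval (f $ i) * \<rho> ^ i < \<rho>"
begin

abbreviation g where "g \<equiv> conjugacy f"

text \<open>
  \<open>d\<close> is the only absolute value below \<open>1\<close> of a divisor \<open>l - l ^ n\<close> with \<open>n\<close> divisible by \<open>p\<close>, \<open>\<sigma>\<close> is the radius of the
  linearization disc, and the conjugacy still has finite Gauss norm at the larger radius \<open>r\<close>, which reflects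
  the spacing \<open>m * p\<close> of the resonances.
\<close>

definition d where "d = absval (1 - l ^ m)"
definition \<sigma> where "\<sigma> = \<rho> * d powr (1 / real (k - 1))"
definition r where "r = \<rho> * d powr (1 / real (m * p))"

text \<open>
  The number of indices \<open>k, k + m p, k + 2 m p, \<dots>\<close> up to \<open>n\<close>. As \<open>k \<le> m p\<close>, the formula
  gives \<open>0\<close> below \<open>k\<close>.
\<close>

definition resonances :: "nat \<Rightarrow> nat"
  where "resonances n = (n + (m * p - k)) div (m * p)"

lemma char_pos: "CHAR('a) > 0"
  using p_pos char_p by simp

lemma prime_p: "prime p"
  using prime_CHAR_semidom[OF char_pos] char_p by simp

lemma m_pos: "1 \<le> m"
  unfolding m_def by (rule mult_order_residue_pos[OF char_pos residue_torsion])

lemma coprime_p_m: "coprime p m"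
  using coprime_mult_order_residue[OF char_pos residue_torsion] by (simp add: char_p m_def)

lemmas resonance_properties = min_resonance_properties[OF coprime_p_m prime_gt_1_nat[OF prime_p]
    m_pos m_def, folded k_def]

lemma k_ge_2: "2 \<le> k" and p_dvd_k: "p dvd k" and m_dvd_k: "m dvd k - 1" and k_le: "k \<le> m * p"
  by (rule resonance_properties(1-4))+

lemma resonantD: "1 \<le> n \<Longrightarrow> p dvd n \<Longrightarrow> m dvd n - 1 \<Longrightarrow> k \<le> n \<and> m * p dvd n - k"
  by (rule resonance_properties(5))

lemma d_pos: "0 < d" and d_less_1: "d < 1"
  using not_root[OF m_pos] absval_one_minus_power_order[OF char_pos residue_torsion, folded m_def]
  by (simp_all add: d_def zero_less_iff_neq_zero less_le)

lemma absval_l: "absval l = 1"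
  by (rule absval_residue_torsion[OF char_pos residue_torsion])

lemma l_nonzero: "l \<noteq> 0"
  using absval_l by auto

lemma g0: "g $ 0 = 0" and g1: "g $ 1 = 1" and g_conj: "g oo f = fps_const l * g"
  using conjugacy_properties[of f] f0 f1 l_nonzero not_root by auto

lemma g_exponents:
  assumes "2 \<le> n" "\<not> p dvd n"
  shows "g $ n = 0"
proof -
  have "of_nat i * f $ i = 0" if "2 \<le> i" for i
    using exponents[OF that] by (cases "p dvd i") (auto simp: of_nat_eq_0_iff_char_dvd char_p)
  then have "of_nat n * g $ n = 0"
    using conjugacy_exponents[of f g n] f0 f1 l_nonzero not_root g_conj assms by auto
  then show ?thesis
    using assms by (simp add: of_nat_eq_0_iff_char_dvd char_p)
qed

text \<open>
  Here \<open>p\<close> does not divide \<open>n - 1\<close>, which excludes the divisors \<open>d ^ (p ^ s)\<close> with \<open>s \<ge> 1\<close>.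
\<close>

lemma divisor:
  assumes "p dvd n" "2 \<le> n"
  shows "absval (l - l ^ n) = (if m dvd n - 1 then d else 1)"
proof -
  have "l - l ^ n = l * (1 - l ^ (n - 1))"
    using assms by (cases n) (simp_all add: algebra_simps)
  moreover have "\<not> p dvd n - 1"
    using assms prime_gt_1_nat[OF prime_p] dvd_diff_nat[OF assms(1), of "n - 1"] by auto
  ultimately show ?thesis
    using absval_one_minus_power_resonant[OF char_pos residue_torsion, of "n - 1", folded m_def]
      absval_one_minus_power_eq_1[OF char_pos residue_torsion, of "n - 1", folded m_def]
    by (simp add: absval_mult absval_l d_def char_p)
qed

lemma recursion: "g $ n * (l - l ^ n) = (\<Sum>j<n. g $ j * (f ^ j) $ n)"
  using g_conj conjugates_iff[OF f0, of g] unfolding f1 by blast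

lemma mp_pos: "0 < m * p"
  using m_pos p_pos by simp

lemma resonances_mono: "i \<le> j \<Longrightarrow> resonances i \<le> resonances j"
  unfolding resonances_def by (intro div_le_mono) simp

lemma resonances_below: "n < k \<Longrightarrow> resonances n = 0"
  unfolding resonances_def using k_le by simp

lemma resonances_step:
  assumes "1 \<le> n" "p dvd n" "m dvd n - 1"
  shows "resonances n = Suc (resonances (n - 1))"
proof -
  obtain q where q: "n - k = m * p * q" and "k \<le> n"
    using resonantD[OF assms] by (auto elim: dvdE)
  have "n + (m * p - k) = m * p * Suc q"
    using q \<open>k \<le> n\<close> k_le by simp
  moreover have "n - 1 + (m * p - k) = (m * p - 1) + q * (m * p)"
    using calculation mp_pos assms(1) by (simp add: mult.commute)
  moreover have "(m * p - 1 + q * (m * p)) div (m * p) = q"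
    using mp_pos by (subst div_mult_self1) auto
  ultimately show ?thesis
    unfolding resonances_def using mp_pos by simp
qed

text \<open>
  In the recursion for \<open>g $ n\<close> every term carries the bound of an index below \<open>n\<close>. Dividing by
  the small divisor costs a factor \<open>1 / d\<close> exactly when \<open>n\<close> is resonant, which is when \<open>resonances\<close>
  increases.
\<close>

lemma coeff_bound: "absval (g $ n) * \<rho> ^ n * d ^ resonances n \<le> \<rho>"
proof (induction n rule: less_induct)
  case (less n)
  consider "n = 0" | "n = 1" | "2 \<le> n" "\<not> p dvd n" | "2 \<le> n" "p dvd n"
    by linarith
  then show ?case
  proof cases
    case 1
    then show ?thesis using rho_pos by (simp add: g0)
  next
    case 2
    then show ?thesis
      using rho_pos resonances_below[of 1] k_ge_2 g1 by simp
  next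
    case 3
    then show ?thesis using rho_pos by (simp add: g_exponents)
  next
    case 4
    let ?R = "resonances (n - 1)"
    have "absval (g $ j * (f ^ j) $ n) \<le> \<rho> / d ^ ?R / \<rho> ^ n" if "j < n" for j
    proof -
      have "absval (g $ j) * \<rho> ^ j * d ^ ?R \<le> absval (g $ j) * \<rho> ^ j * d ^ resonances j"
        using that rho_pos d_pos d_less_1
        by (intro mult_left_mono power_decreasing resonances_mono) auto
      also have "\<dots> \<le> \<rho>"
        using less that by blast
      finally have "absval (g $ j) * \<rho> ^ j \<le> \<rho> / d ^ ?R"
        using d_pos by (simp add: pos_le_divide_eq)
      from gauss_bound_coeff_mult_power[OF char_pos bound this rho_pos, of n] show ?thesis
        using rho_pos by (subst pos_le_divide_eq) auto
    qed
    then have "absval (g $ n * (l - l ^ n)) \<le> \<rho> / d ^ ?R / \<rho> ^ n"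
      unfolding recursion using rho_pos d_pos by (intro absval_sum_le[OF char_pos]) auto
    then have "absval (g $ n) * absval (l - l ^ n) * d ^ ?R * \<rho> ^ n \<le> \<rho>"
      using rho_pos d_pos by (simp add: absval_mult pos_le_divide_eq)
    moreover have "absval (l - l ^ n) * d ^ ?R \<ge> d ^ resonances n"
    proof (cases "m dvd n - 1")
      case True
      then show ?thesis using resonances_step[of n] divisor[of n] 4 by simp
    next
      case False
      then show ?thesis
        using divisor[of n] 4 d_pos d_less_1 resonances_mono[of "n - 1" n]
        by (simp add: power_decreasing)
    qed
    then have "absval (g $ n) * \<rho> ^ n * d ^ resonances n
        \<le> absval (g $ n) * \<rho> ^ n * (absval (l - l ^ n) * d ^ ?R)"
      using rho_pos by (intro mult_left_mono) auto
    ultimately show ?thesis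
      by (simp add: mult_ac)
  qed
qed

text \<open>
  There is no resonance below \<open>k\<close>, so the strict inequalities for \<open>f\<close> pass to \<open>g\<close>.
\<close>

lemma coeff_bound_strict:
  assumes "2 \<le> n" "n < k"
  shows "absval (g $ n) * \<rho> ^ n < \<rho>"
  using assms
proof (induction n rule: less_induct)
  case (less n)
  have small: "absval (g $ j * (f ^ j) $ n) < \<rho> / \<rho> ^ n" if "j < n" for j
  proof -
    consider "j = 0" | "j = 1" | "2 \<le> j"
      by linarith
    then show ?thesis
    proof cases
      case 1
      then show ?thesis using rho_pos by (simp add: g0)
    next
      case 2
      then show ?thesis
        using below[of n] less.prems g1 rho_pos by (simp add: pos_less_divide_eq)
    next
      case 3
      have "absval (g $ j * (f ^ j) $ n) * \<rho> ^ n \<le> absval (g $ j) * \<rho> ^ j"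
        by (rule gauss_bound_coeff_mult_power[OF char_pos bound order_refl rho_pos])
      also have "\<dots> < \<rho>"
        using less 3 that by simp
      finally show ?thesis
        using rho_pos by (simp add: pos_less_divide_eq)
    qed
  qed
  show ?case
  proof (cases "p dvd n")
    case True
    have "\<not> m dvd n - 1"
      using resonantD[of n] True less.prems by auto
    then have "absval (g $ n * (l - l ^ n)) = absval (g $ n)"
      using divisor[OF True] less.prems by (simp add: absval_mult)
    moreover have "absval (g $ n * (l - l ^ n)) < \<rho> / \<rho> ^ n"
      unfolding recursion using small rho_pos by (intro absval_sum_less[OF char_pos]) auto
    ultimately show ?thesis
      using rho_pos by (simp add: pos_less_divide_eq)
  qed (use g_exponents less.prems rho_pos in simp)
qed

text \<open>
  By \<open>coeff_bound_strict\<close> the term \<open>f $ k\<close>, which comes from \<open>j = 1\<close>, strictly dominates the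
  recursion at the first resonance.
\<close>

lemma coeff_resonant: "absval (g $ k) * \<rho> ^ k * d = \<rho>"
proof -
  have small: "absval (g $ j * (f ^ j) $ k) < \<rho> / \<rho> ^ k" if "j \<in> {..<k} - {1}" for j
  proof (cases "j = 0")
    case False
    then have "2 \<le> j"
      using that by auto
    have "absval (g $ j * (f ^ j) $ k) * \<rho> ^ k \<le> absval (g $ j) * \<rho> ^ j"
      by (rule gauss_bound_coeff_mult_power[OF char_pos bound order_refl rho_pos])
    also have "\<dots> < \<rho>"
      using coeff_bound_strict[OF \<open>2 \<le> j\<close>] that by simp
    finally show ?thesis
      using rho_pos by (simp add: pos_less_divide_eq)
  qed (use rho_pos in \<open>simp add: g0\<close>)
  have "g $ k * (l - l ^ k) = f $ k + (\<Sum>j\<in>{..<k} - {1}. g $ j * (f ^ j) $ k)"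
    unfolding recursion using k_ge_2 g1 by (subst sum.remove[of _ 1]) auto
  moreover have fk: "absval (f $ k) = \<rho> / \<rho> ^ k"
    using dominant rho_pos by (simp add: field_simps)
  moreover have "absval (\<Sum>j\<in>{..<k} - {1}. g $ j * (f ^ j) $ k) < \<rho> / \<rho> ^ k"
    using rho_pos by (intro absval_sum_less[OF char_pos] small) auto
  ultimately have "absval (g $ k * (l - l ^ k)) = \<rho> / \<rho> ^ k"
    using absval_add_dominant[OF char_pos] by simp
  then have "absval (g $ k) * d = \<rho> / \<rho> ^ k"
    using divisor[OF p_dvd_k k_ge_2] m_dvd_k by (simp only: absval_mult if_True)
  then show ?thesis
    using rho_pos by (simp add: field_simps)
qed

lemma sigma_pos: "0 < \<sigma>" and sigma_less_r: "\<sigma> < r" and r_less_rho: "r < \<rho>"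
proof -
  show "0 < \<sigma>"
    using rho_pos d_pos by (simp add: \<sigma>_def)
  have "real (k - 1) < real (m * p)" "0 < real (k - 1)"
    using k_le k_ge_2 by linarith+
  then have "1 / real (m * p) < 1 / real (k - 1)"
    by (intro divide_strict_left_mono mult_pos_pos) linarith+
  then show "\<sigma> < r"
    unfolding \<sigma>_def r_def using rho_pos d_pos d_less_1
    by (intro mult_strict_left_mono powr_less_mono') auto
  have "d powr (1 / real (m * p)) < d powr 0"
    using d_pos d_less_1 mp_pos by (intro powr_less_mono') (auto simp del: of_nat_mult)
  then show "r < \<rho>"
    unfolding r_def using rho_pos d_pos by simp
qed

text \<open>
  Since \<open>resonances n \<le> n / (m * p) + 1\<close>, the loss in \<open>coeff_bound\<close> is absorbed by
  \<open>(r / \<rho>) ^ n = d powr (n / (m * p))\<close> up to one factor \<open>1 / d\<close>.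
\<close>

lemma gauss_bound_g: "gauss_bound r (\<rho> / d) g"
  unfolding gauss_bound_def
proof
  fix n
  have "real (resonances n) \<le> real (n + (m * p - k)) / real (m * p)"
    unfolding resonances_def by (rule of_nat_div_le_of_nat)
  also have "\<dots> \<le> (real n + real (m * p)) / real (m * p)"
    by (intro divide_right_mono) linarith+
  finally have le: "real (resonances n) - 1 \<le> real n * (1 / real (m * p))"
    using mp_pos by (simp add: add_divide_distrib del: of_nat_mult)
  have "r ^ n = \<rho> ^ n * d powr (real n * (1 / real (m * p)))"
    unfolding r_def power_mult_distrib using d_pos by (simp add: powr_powr mult.commute flip: powr_realpow)
  also have "\<dots> \<le> \<rho> ^ n * d powr (real (resonances n) - 1)"
    using le rho_pos d_pos d_less_1 by (intro mult_left_mono powr_mono') auto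
  also have "\<dots> = \<rho> ^ n * d ^ resonances n / d"
    using d_pos by (simp add: powr_diff powr_realpow)
  finally have "absval (g $ n) * r ^ n \<le> absval (g $ n) * (\<rho> ^ n * d ^ resonances n / d)"
    by (intro mult_left_mono) auto
  also have "\<dots> \<le> \<rho> / d"
    using coeff_bound[of n] d_pos by (simp add: divide_right_mono mult_ac)
  finally show "absval (g $ n) * r ^ n \<le> \<rho> / d" .
qed

lemma sigma_power:
  assumes "1 \<le> n"
  shows "\<sigma> ^ n = \<rho> ^ n * d powr (1 / real (k - 1)) * d powr (real (n - 1) / real (k - 1))"
proof -
  have "\<sigma> ^ n = \<rho> ^ n * d powr (real n / real (k - 1))"
    unfolding \<sigma>_def power_mult_distrib using d_pos by (simp add: powr_powr flip: powr_realpow)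
  also have "real n / real (k - 1) = 1 / real (k - 1) + real (n - 1) / real (k - 1)"
    using assms by (simp add: of_nat_diff flip: add_divide_distrib)
  finally show ?thesis
    by (simp add: powr_add)
qed

lemma coeff_sigma_k: "absval (g $ k) * \<sigma> ^ k = \<sigma>"
proof -
  have "absval (g $ k) * \<sigma> ^ k = absval (g $ k) * \<rho> ^ k * d * d powr (1 / real (k - 1))"
    using k_ge_2 d_pos by (simp add: sigma_power)
  then show ?thesis
    by (simp add: coeff_resonant \<sigma>_def)
qed

text \<open>
  By \<open>sigma_power\<close> and \<open>coeff_bound\<close> the claim is \<open>resonances n < (n - 1) / (k - 1)\<close>. Both sides are
  \<open>1\<close> at \<open>n = k\<close>; from there the upper bound for \<open>resonances\<close> grows with slope \<open>1 / (m * p)\<close>,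
  the right side with the larger slope \<open>1 / (k - 1)\<close>.
\<close>

lemma coeff_sigma_less:
  assumes "n \<noteq> 1" "n \<noteq> k"
  shows "absval (g $ n) * \<sigma> ^ n < \<sigma>"
proof (cases "n = 0")
  case True
  then show ?thesis using sigma_pos by (simp add: g0)
next
  case False
  then have n: "2 \<le> n"
    using assms by linarith
  have exponent: "real (resonances n) < real (n - 1) / real (k - 1)"
  proof (cases "n < k")
    case True
    then show ?thesis using n by (simp add: resonances_below)
  next
    case False
    then have nk: "k < n"
      using assms by simp
    have "real (resonances n) \<le> real (n + (m * p - k)) / real (m * p)"
      unfolding resonances_def by (rule of_nat_div_le_of_nat)
    also have "\<dots> = 1 + real (n - k) / real (m * p)"
      using nk k_le mp_pos by (simp add: of_nat_diff field_simps del: of_nat_mult)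
    also have "\<dots> < 1 + real (n - k) / real (k - 1)"
      using nk k_le k_ge_2
      by (intro add_strict_left_mono divide_strict_left_mono mult_pos_pos) linarith+
    also have "\<dots> = real (n - 1) / real (k - 1)"
      using nk k_ge_2 by (simp add: of_nat_diff field_simps)
    finally show ?thesis .
  qed
  show ?thesis
  proof (cases "g $ n = 0")
    case False
    then have pos: "0 < absval (g $ n)"
      by (simp add: less_le)
    have "absval (g $ n) * \<sigma> ^ n
        = absval (g $ n) * \<rho> ^ n * d powr (1 / real (k - 1)) * d powr (real (n - 1) / real (k - 1))"
      using n by (simp add: sigma_power)
    also have "\<dots> < absval (g $ n) * \<rho> ^ n * d powr (1 / real (k - 1)) * d powr real (resonances n)"
      using exponent pos rho_pos d_pos d_less_1
      by (intro mult_strict_left_mono powr_less_mono' mult_pos_pos zero_less_power) auto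
    also have "\<dots> = absval (g $ n) * \<rho> ^ n * d ^ resonances n * d powr (1 / real (k - 1))"
      using d_pos by (simp add: powr_realpow)
    also have "\<dots> \<le> \<rho> * d powr (1 / real (k - 1))"
      using coeff_bound[of n] by (intro mult_right_mono) auto
    finally show ?thesis by (simp add: \<sigma>_def)
  qed (use sigma_pos in simp)
qed

lemma gauss_degree_g: "gauss_degree \<sigma> \<sigma> k g"
proof -
  have "absval (g $ n) * \<sigma> ^ n \<le> \<sigma>" for n
    using coeff_sigma_less[of n] coeff_sigma_k g1 by (cases "n = 1 \<or> n = k") auto
  then show ?thesis
    using coeff_sigma_less coeff_sigma_k k_ge_2 by (auto simp: gauss_degree_def gauss_bound_def)
qed

end

section \<open>The inverse series\<close>

lemma gauss_bound_fps_inv: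
  fixes g :: "'a::abs_value_field fps"
  assumes char_pos: "CHAR('a) > 0" and g0: "g $ 0 = 0" and g1: "g $ 1 = 1"
    and bound: "gauss_bound s s g" and s: "0 < s"
  shows "gauss_bound s s (fps_inv g)"
proof -
  let ?c = "fps_inv g"
  have inv: "?c oo g = fps_X"
    using fps_inv[OF g0] g1 by simp
  have "absval (?c $ n) * s ^ n \<le> s" for n
  proof (induction n rule: less_induct)
    case (less n)
    have "absval (?c $ j * (g ^ j) $ n) \<le> s / s ^ n" if "j < n" for j
      using gauss_bound_coeff_mult_power[OF char_pos bound less[OF that] s, of n] s
      by (simp add: pos_le_divide_eq)
    then have sum: "absval (\<Sum>j<n. ?c $ j * (g ^ j) $ n) \<le> s / s ^ n"
      using s by (intro absval_sum_le[OF char_pos]) auto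
    have "?c $ n = fps_X $ n - (\<Sum>j<n. ?c $ j * (g ^ j) $ n)"
      using fps_compose_nth_split[OF g0, of ?c n] by (simp only: inv g1 power_one) simp
    moreover have "absval (fps_X $ n :: 'a) \<le> s / s ^ n"
      using s by auto
    ultimately have "absval (?c $ n) \<le> s / s ^ n"
      using sum absval_diff_le[OF char_pos] by metis
    then show ?case
      using s by (simp add: pos_le_divide_eq)
  qed
  then show ?thesis
    by (simp add: gauss_bound_def)
qed

text \<open>
  Convergence at \<open>x\<close> would make the coefficients of the inverse series \<open>c\<close> small at radius \<open>s\<close>, so \<open>c\<close>
  would have some Weierstrass degree \<open>N \<ge> 1\<close> there. In the coefficient of \<open>g oo c\<close> at \<open>k * N\<close>
  the term \<open>g $ k * (c ^ k) $ (k * N)\<close> then strictly dominates all others: for \<open>j < k\<close> the index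
  \<open>k * N\<close> exceeds the degree \<open>j * N\<close> of \<open>c ^ j\<close>, and for \<open>j > k\<close> the coefficient \<open>g $ j\<close> is small. Yet this
  coefficient of \<open>g oo c = fps_X\<close> is \<open>0\<close>.
\<close>

lemma inverse_series_diverges:
  fixes g :: "'a::abs_value_field fps"
  assumes char_pos: "CHAR('a) > 0" and g0: "g $ 0 = 0" and g1: "g $ 1 = 1"
    and degree: "gauss_degree s s k g" and k: "2 \<le> k" and s: "0 < s" and x: "s \<le> absval x"
  shows "\<not> fps_converges (fps_inv g) x"
proof
  let ?c = "fps_inv g"
  assume conv: "fps_converges ?c x"
  have bound: "gauss_bound s s ?c"
    using gauss_bound_fps_inv[OF char_pos g0 g1 _ s] degree by (simp add: gauss_degree_def)
  have "(\<lambda>n. (\<Sum>i<Suc n. ?c $ i * x ^ i) - (\<Sum>i<n. ?c $ i * x ^ i)) \<longlonglongrightarrow> fps_value ?c x - fps_value ?c x"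
    using fps_value_LIMSEQ[OF conv] by (intro tendsto_diff LIMSEQ_Suc) auto
  then have "(\<lambda>n. absval (?c $ n * x ^ n)) \<longlonglongrightarrow> 0"
    by (simp add: tendsto_absval_iff)
  then have "eventually (\<lambda>n. absval (?c $ n * x ^ n) < s) sequentially"
    using order_tendstoD(2) s by blast
  then obtain M where M: "\<And>n. M \<le> n \<Longrightarrow> absval (?c $ n * x ^ n) < s"
    by (auto simp: eventually_sequentially)
  have tail: "absval (?c $ n) * s ^ n < s" if "M \<le> n" for n
  proof -
    have "absval (?c $ n) * s ^ n \<le> absval (?c $ n) * absval x ^ n"
      using s x by (intro mult_left_mono power_mono) auto
    then show ?thesis
      using M[OF that] by (simp add: absval_mult)
  qed
  define T where "T = {n. absval (?c $ n) * s ^ n = s}"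
  have "T \<subseteq> {..<M}"
  proof
    fix n
    assume "n \<in> T"
    then show "n \<in> {..<M}"
      using tail[of n] by (cases "M \<le> n") (auto simp: T_def)
  qed
  then have "finite T"
    by (rule finite_subset) simp
  have "?c $ 1 = 1"
    using arg_cong[OF fps_inv[OF g0], of "\<lambda>h. h $ 1"] fps_compose_nth_split[OF g0, of ?c 1] g1
    by (simp add: fps_inv_def)
  then have "1 \<in> T"
    by (simp add: T_def)
  define N where "N = Max T"
  have "N \<in> T" and "1 \<le> N"
    using \<open>finite T\<close> \<open>1 \<in> T\<close> by (auto simp: N_def intro: Max_in)
  have "absval (?c $ n) * s ^ n < s" if "N < n" for n
  proof -
    have "n \<notin> T"
      using that Max_ge[OF \<open>finite T\<close>, of n] by (auto simp: N_def)
    then show ?thesis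
      using bound by (auto simp: T_def gauss_bound_def less_le)
  qed
  then have cN: "gauss_degree s s N ?c"
    using bound \<open>N \<in> T\<close> by (simp add: gauss_degree_def T_def)
  note power = gauss_degree_power[OF char_pos cN s s]
  let ?t = "\<lambda>j. g $ j * (?c ^ j) $ (k * N)"
  have top: "absval (?t k) = s / s ^ (k * N)"
  proof -
    have "absval (?t k) * s ^ (k * N) = absval (g $ k) * (absval ((?c ^ k) $ (k * N)) * s ^ (k * N))"
      by (simp add: absval_mult)
    also have "\<dots> = s"
      using power[of k] degree by (simp add: gauss_degree_def)
    finally show ?thesis
      using s by (simp add: field_simps)
  qed
  have other: "absval (?t j) < s / s ^ (k * N)" if "j \<noteq> k" for j
  proof -
    have split: "absval (?t j) * s ^ (k * N) = absval (g $ j) * (absval ((?c ^ j) $ (k * N)) * s ^ (k * N))"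
      by (simp add: absval_mult)
    have g_le: "absval (g $ j) * s ^ j \<le> s"
      using degree by (simp add: gauss_degree_def gauss_bound_def)
    have "absval (g $ j) * (absval ((?c ^ j) $ (k * N)) * s ^ (k * N)) < s"
    proof (cases "g $ j = 0")
      case False
      then have gj: "0 < absval (g $ j)"
        by (simp add: less_le)
      show ?thesis
      proof (cases "j < k")
        case True
        then have "absval ((?c ^ j) $ (k * N)) * s ^ (k * N) < s ^ j"
          using power[of j] \<open>1 \<le> N\<close> by (simp add: gauss_degree_def)
        then show ?thesis
          using mult_strict_left_mono[OF _ gj] g_le by (meson less_le_trans)
      next
        case False
        then have "absval (g $ j) * s ^ j < s"
          using degree that by (simp add: gauss_degree_def)
        moreover have "absval ((?c ^ j) $ (k * N)) * s ^ (k * N) \<le> s ^ j"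
          using power[of j] by (simp add: gauss_degree_def gauss_bound_def)
        ultimately show ?thesis
          using mult_left_mono[OF _ less_imp_le[OF gj]] by (meson le_less_trans)
      qed
    qed (use s in simp)
    then show ?thesis
      using split s by (simp add: pos_less_divide_eq)
  qed
  have kN: "2 \<le> k * N" "k \<le> k * N"
    using k \<open>1 \<le> N\<close> mult_le_mono[OF k \<open>1 \<le> N\<close>] by simp_all
  have "g oo ?c = fps_X"
    using fps_inv_right[OF g0] g1 by simp
  moreover have "k * N \<noteq> 1"
    using kN by linarith
  ultimately have "(g oo ?c) $ (k * N) = 0"
    by (simp only: fps_X_nth if_False)
  then have "0 = ?t k + (\<Sum>j\<in>{0..k * N} - {k}. ?t j)"
    unfolding fps_compose_nth using kN by (subst (asm) sum.remove[of _ k]) auto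
  moreover have "absval (\<Sum>j\<in>{0..k * N} - {k}. ?t j) < absval (?t k)"
    unfolding top using s by (intro absval_sum_less[OF char_pos] other) auto
  ultimately have "absval (0 :: 'a) = absval (?t k)"
    using absval_add_dominant[OF char_pos] by metis
  then show False
    using top s by simp
qed

section \<open>Dynamics near a linearizable fixed point\<close>

text \<open>
  Taylor's formula with an ultrametric remainder, multiplied by \<open>s\<^sup>2\<close> to avoid the exponent \<open>i - 2\<close>.
\<close>

lemma power_diff_tangent:
  fixes x y :: "'a::abs_value_field"
  assumes char_pos: "CHAR('a) > 0" and xy: "absval x \<le> s" "absval y \<le> s"
  shows "absval (x ^ i - y ^ i - of_nat i * y ^ (i - 1) * (x - y)) * s\<^sup>2 \<le> (absval (x - y))\<^sup>2 * s ^ i"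
proof (induction i)
  case (Suc i)
  let ?D = "x ^ i - y ^ i - of_nat i * y ^ (i - 1) * (x - y)"
  have s: "0 \<le> s"
    using xy(1) absval_nonneg[of x] by linarith
  show ?case
  proof (cases "i = 0")
    case False
    then have yi: "y ^ i = y * y ^ (i - 1)"
      by (cases i) auto
    have eq: "x ^ Suc i - y ^ Suc i - of_nat (Suc i) * y ^ (Suc i - 1) * (x - y)
        = x * ?D + of_nat i * y ^ (i - 1) * (x - y)\<^sup>2"
      by (simp add: yi algebra_simps power2_eq_square)
    define M where "M = max (absval (x * ?D)) (absval (of_nat i * y ^ (i - 1) * (x - y)\<^sup>2))"
    have "absval (x * ?D) * s\<^sup>2 = absval x * (absval ?D * s\<^sup>2)"
      by (simp add: absval_mult)
    also have "\<dots> \<le> s * ((absval (x - y))\<^sup>2 * s ^ i)"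
      using xy s by (intro mult_mono Suc.IH) simp_all
    finally have 1: "absval (x * ?D) * s\<^sup>2 \<le> (absval (x - y))\<^sup>2 * s ^ Suc i"
      by (simp add: mult_ac)
    have "absval (of_nat i * y ^ (i - 1) * (x - y)\<^sup>2) * s\<^sup>2
        = absval (of_nat i :: 'a) * absval y ^ (i - 1) * (absval (x - y))\<^sup>2 * s\<^sup>2"
      by (simp add: absval_mult)
    also have "\<dots> \<le> 1 * s ^ (i - 1) * (absval (x - y))\<^sup>2 * s\<^sup>2"
      using xy s absval_of_nat_le[OF char_pos, of i]
      by (intro mult_right_mono mult_mono power_mono) auto
    also have "\<dots> = (absval (x - y))\<^sup>2 * s ^ Suc i"
      using False by (cases i) (simp_all add: power2_eq_square)
    finally have 2: "absval (of_nat i * y ^ (i - 1) * (x - y)\<^sup>2) * s\<^sup>2 \<le> (absval (x - y))\<^sup>2 * s ^ Suc i" .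
    have "absval (x * ?D + of_nat i * y ^ (i - 1) * (x - y)\<^sup>2) * s\<^sup>2 \<le> M * s\<^sup>2"
      unfolding M_def by (intro mult_right_mono ultrametric[OF char_pos]) auto
    also have "\<dots> \<le> (absval (x - y))\<^sup>2 * s ^ Suc i"
      using 1 2 by (auto simp: M_def max_def)
    finally show ?thesis
      unfolding eq .
  qed (use s in simp)
qed simp

text \<open>
  All exponents from \<open>2\<close> on that occur in \<open>h\<close> vanish in the field, so the linear terms of
  \<open>power_diff_tangent\<close> drop out and the derivative of \<open>h\<close> is \<open>h $ 1\<close> everywhere. This one estimate yields
  the local injectivity of the conjugacy, the contraction that produces its zeros, and the
  multipliers of \<open>f\<close>.
\<close>

lemma series_tangent:
  fixes h :: "'a::{abs_value_field, complete_space} fps"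
  assumes char_pos: "CHAR('a) > 0" and exponents: "\<And>i. 2 \<le> i \<Longrightarrow> of_nat i * h $ i = 0"
    and bound: "gauss_bound s s h" and s: "0 < s"
    and conv: "fps_converges h x" "fps_converges h y" and xy: "absval x \<le> s" "absval y \<le> s"
  shows "absval (fps_value h x - fps_value h y - h $ 1 * (x - y)) \<le> (absval (x - y))\<^sup>2 / s"
proof -
  let ?S = "\<lambda>x n. \<Sum>i<n. h $ i * x ^ i"
  let ?B = "(absval (x - y))\<^sup>2 / s"
  have term_le: "absval (h $ i * (x ^ i - y ^ i)) \<le> ?B" if "i \<noteq> 1" for i
  proof (cases "i = 0 \<or> h $ i = 0")
    case False
    then have "of_nat i = (0 :: 'a)"
      using exponents[of i] that by auto
    then have "absval (x ^ i - y ^ i) * s\<^sup>2 \<le> (absval (x - y))\<^sup>2 * s ^ i"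
      using power_diff_tangent[OF char_pos xy, of i] by simp
    then have "absval (x ^ i - y ^ i) \<le> (absval (x - y))\<^sup>2 / s\<^sup>2 * s ^ i"
      using s by (simp add: field_simps)
    then have "absval (h $ i) * absval (x ^ i - y ^ i) \<le> absval (h $ i) * ((absval (x - y))\<^sup>2 / s\<^sup>2 * s ^ i)"
      by (intro mult_left_mono) auto
    also have "\<dots> = absval (h $ i) * s ^ i * ((absval (x - y))\<^sup>2 / s\<^sup>2)"
      by simp
    also have "\<dots> \<le> s * ((absval (x - y))\<^sup>2 / s\<^sup>2)"
      using bound by (intro mult_right_mono) (auto simp: gauss_bound_def)
    also have "\<dots> = ?B"
      using s by (simp add: power2_eq_square)
    finally show ?thesis
      by (simp add: absval_mult)
  qed (use s in auto)
  have "?S x (n + 2) - ?S y (n + 2) - h $ 1 * (x - y) \<in> {z. absval z \<le> ?B}" for n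
  proof -
    have "?S x (n + 2) - ?S y (n + 2) = (\<Sum>i<n + 2. h $ i * (x ^ i - y ^ i))"
      by (simp add: right_diff_distrib sum_subtractf)
    also have "\<dots> = h $ 1 * (x - y) + (\<Sum>i\<in>{..<n + 2} - {1}. h $ i * (x ^ i - y ^ i))"
      by (subst sum.remove[of _ 1]) auto
    finally have "?S x (n + 2) - ?S y (n + 2) - h $ 1 * (x - y)
        = (\<Sum>i\<in>{..<n + 2} - {1}. h $ i * (x ^ i - y ^ i))"
      by (simp only: add_diff_cancel_left')
    also have "absval \<dots> \<le> ?B"
      using s by (intro absval_sum_le[OF char_pos] term_le) auto
    finally show ?thesis by simp
  qed
  moreover have "(\<lambda>n. ?S x (n + 2) - ?S y (n + 2) - h $ 1 * (x - y))
      \<longlonglongrightarrow> fps_value h x - fps_value h y - h $ 1 * (x - y)"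
    by (intro tendsto_diff tendsto_const LIMSEQ_ignore_initial_segment[OF fps_value_LIMSEQ] conv)
  ultimately have "fps_value h x - fps_value h y - h $ 1 * (x - y) \<in> {z. absval z \<le> ?B}"
    by (rule closed_sequentially[OF closed_absval_le])
  then show ?thesis
    by (simp only: mem_Collect_eq)
qed

text \<open>
  A series \<open>f\<close> together with its conjugacy \<open>g\<close> over a complete field. It is used over the ground
  field, for the linearization disc, and for the images of both series over the completed algebraic
  closure, where the periodic points live.
\<close>

locale linearizing_series =
  fixes f g :: "'a::{abs_value_field, complete_space} fps" and l :: 'a and \<sigma> r \<rho> C :: real
  assumes char_pos: "CHAR('a) > 0"
    and f0: "f $ 0 = 0" and f1: "f $ 1 = l" and absval_l: "absval l = 1"
    and f_exponents: "2 \<le> i \<Longrightarrow> of_nat i * f $ i = 0"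
    and f_bound: "gauss_bound \<rho> \<rho> f"
    and g0: "g $ 0 = 0" and g1: "g $ 1 = 1"
    and g_exponents: "2 \<le> i \<Longrightarrow> of_nat i * g $ i = 0"
    and g_bound: "gauss_bound \<sigma> \<sigma> g" and g_bound_r: "gauss_bound r C g"
    and sigma_pos: "0 < \<sigma>" and sigma_less: "\<sigma> < r" and r_less: "r < \<rho>"
    and conj: "g oo f = fps_const l * g"
begin

lemma f_bound_le: "0 < s \<Longrightarrow> s \<le> \<rho> \<Longrightarrow> gauss_bound s s f"
  by (rule gauss_bound_shrink[OF f_bound f0])

lemma f_converges: "absval x \<le> \<sigma> \<Longrightarrow> fps_converges f x"
  using fps_convergesI[OF char_pos f_bound] sigma_less r_less by simp

lemma g_converges: "absval x \<le> \<sigma> \<Longrightarrow> fps_converges g x"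
  using fps_convergesI[OF char_pos g_bound_r] sigma_less by simp

lemma f_tangent:
  assumes "absval x \<le> \<sigma>" "absval y \<le> \<sigma>"
  shows "absval (fps_value f x - fps_value f y - l * (x - y)) \<le> (absval (x - y))\<^sup>2 / \<sigma>"
  using series_tangent[OF char_pos f_exponents f_bound_le sigma_pos f_converges f_converges assms] assms
    sigma_pos sigma_less r_less
  by (simp del: One_nat_def add: f1)

lemma g_tangent:
  assumes "absval x \<le> \<sigma>" "absval y \<le> \<sigma>"
  shows "absval (fps_value g x - fps_value g y - (x - y)) \<le> (absval (x - y))\<^sup>2 / \<sigma>"
  using series_tangent[OF char_pos g_exponents g_bound sigma_pos g_converges g_converges assms] assms
  by (simp del: One_nat_def add: g1)

text \<open>
  \<open>series_tangent\<close> on the disc of radius \<open>\<rho>\<close>; the inequality is strict because \<open>\<bar>x\<bar> \<le> \<sigma> < \<rho>\<close>.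
\<close>

lemma f_near_rotation:
  assumes "absval x \<le> \<sigma>" "x \<noteq> 0"
  shows "absval (fps_value f x - l * x) < absval x"
proof -
  have rho: "0 < \<rho>" "absval x < \<rho>"
    using assms sigma_pos sigma_less r_less by auto
  have "absval (fps_value f x - l * x) \<le> (absval x)\<^sup>2 / \<rho>"
    using series_tangent[OF char_pos f_exponents f_bound rho(1) f_converges[OF assms(1)], of 0] rho
    by (simp del: One_nat_def add: f1 f0)
  also have "\<dots> < absval x"
  proof -
    have "absval x * absval x < absval x * \<rho>"
      using rho assms by (intro mult_strict_left_mono) (auto simp: less_le)
    then show ?thesis
      using rho by (simp add: power2_eq_square pos_divide_less_eq)
  qed
  finally show ?thesis .
qed

lemma absval_f:
  assumes "absval x \<le> \<sigma>"
  shows "absval (fps_value f x) = absval x"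
proof (cases "x = 0")
  case False
  have "absval (l * x + (fps_value f x - l * x)) = absval (l * x)"
    using f_near_rotation[OF assms False]
    by (intro absval_add_dominant[OF char_pos]) (simp add: absval_mult absval_l)
  then show ?thesis
    by (simp add: absval_mult absval_l)
qed (simp add: f0)

text \<open>
  Points with \<open>\<bar>x\<bar> = \<sigma>\<close> are included since \<open>g\<close> has finite Gauss norm at the larger radius \<open>r\<close>.
\<close>

lemma g_semiconjugates:
  assumes "absval x \<le> \<sigma>"
  shows "fps_value g (fps_value f x) = l * fps_value g x"
proof -
  have "fps_value g (fps_value f x) = fps_value (g oo f) x"
    using fps_value_compose(2)[OF char_pos g_bound_r f_bound_le f0] assms sigma_pos sigma_less r_less
    by simp
  then show ?thesis
    by (simp add: conj fps_value_const_mult[OF g_converges[OF assms]])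
qed

text \<open>
  On a residue disc of radius \<open>\<sigma>\<close> the remainder in \<open>g_tangent\<close> is smaller than \<open>\<bar>x - y\<bar>\<close>,
  so \<open>g\<close> is isometric there.
\<close>

lemma g_inj_near:
  assumes "absval x \<le> \<sigma>" "absval y \<le> \<sigma>" "absval (x - y) < \<sigma>" "fps_value g x = fps_value g y"
  shows "x = y"
proof (rule ccontr)
  assume "x \<noteq> y"
  then have pos: "0 < absval (x - y)"
    by (simp add: less_le)
  have "absval (x - y) * \<sigma> \<le> absval (x - y) * absval (x - y)"
    using g_tangent[OF assms(1,2)] assms(4) sigma_pos
    by (simp add: absval_diff_commute pos_le_divide_eq power2_eq_square)
  then show False
    using pos assms(3) by simp
qed

lemma full_conjugacy_ball:
  assumes "g = conjugacy f"
  shows "full_conjugacy_on f (ball 0 \<sigma>)"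
proof -
  let ?c = "fps_inv g"
  have c0: "?c $ 0 = 0"
    by (simp add: fps_inv_def)
  have c_bound: "gauss_bound \<sigma> \<sigma> ?c"
    by (rule gauss_bound_fps_inv[OF char_pos g0 g1 g_bound sigma_pos])
  have "inj_on (fps_value g) (ball 0 \<sigma>)"
    using g_inj_near absval_diff_less[OF char_pos] by (auto intro!: inj_onI)
  moreover have "fps_converges g x" "fps_converges ?c x"
    "fps_converges f (fps_value ?c x)" "fps_converges g (fps_value f (fps_value ?c x))"
    "fps_value g (fps_value f (fps_value ?c x)) = l * x" if "absval x < \<sigma>" for x
  proof -
    show "fps_converges g x"
      using that by (intro g_converges) simp
    show "fps_converges ?c x"
      by (rule fps_convergesI[OF char_pos c_bound that])
    note compose = fps_value_compose[OF char_pos g_bound c_bound c0 sigma_pos that]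
    have y: "absval (fps_value ?c x) \<le> \<sigma>"
      using compose(1) by simp
    show "fps_converges f (fps_value ?c x)" "fps_converges g (fps_value f (fps_value ?c x))"
      using f_converges[OF y] g_converges absval_f[OF y] y by simp_all
    have "g oo ?c = fps_X"
      using fps_inv_right[OF g0] g1 by simp
    then show "fps_value g (fps_value f (fps_value ?c x)) = l * x"
      using g_semiconjugates[OF y] compose(2) by (simp add: fps_value_X)
  qed
  ultimately show ?thesis
    unfolding full_conjugacy_on_def assms[symmetric] by (simp add: f1[simplified] Let_def)
qed

text \<open>
  The two terms of full size cancel. The others are individually below \<open>\<sigma>\<close> and
  tend to \<open>0\<close>, so a single bound \<open>B < \<sigma>\<close> serves for all of them.
\<close>

lemma value_at_approximate_zero:
  assumes z: "absval z = \<sigma>" and k: "1 < k" and cancel: "z + g $ k * z ^ k = 0"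
    and small: "\<And>n. n \<noteq> 1 \<Longrightarrow> n \<noteq> k \<Longrightarrow> absval (g $ n) * \<sigma> ^ n < \<sigma>"
  shows "absval (fps_value g z) < \<sigma>"
proof -
  have "(\<lambda>n. C * (\<sigma> / r) ^ n) \<longlonglongrightarrow> C * 0"
    using sigma_pos sigma_less by (intro tendsto_intros LIMSEQ_power_zero) auto
  then have "eventually (\<lambda>n. C * (\<sigma> / r) ^ n < \<sigma> / 2) sequentially"
    using order_tendstoD(2)[of _ "C * 0" sequentially "\<sigma> / 2"] sigma_pos by simp
  then obtain N where N: "\<And>n. N \<le> n \<Longrightarrow> C * (\<sigma> / r) ^ n < \<sigma> / 2"
    by (auto simp: eventually_sequentially)
  define B where "B = Max (insert (\<sigma> / 2) ((\<lambda>n. absval (g $ n) * \<sigma> ^ n) ` ({..<N} - {1, k})))"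
  have "B < \<sigma>"
    using small sigma_pos by (simp add: B_def)
  have "\<sigma> / 2 \<le> B"
    unfolding B_def by (intro Max_ge) auto
  have term_le: "absval (g $ n * z ^ n) \<le> B" if "n \<noteq> 1" "n \<noteq> k" for n
  proof (cases "n < N")
    case True
    then show ?thesis
      unfolding B_def using that z by (intro Max_ge) (auto simp: absval_mult)
  next
    case False
    have "absval (g $ n) * \<sigma> ^ n \<le> C * (\<sigma> / r) ^ n"
      using sigma_pos sigma_less by (intro gauss_bound_nth_le[OF g_bound_r]) auto
    also have "\<dots> \<le> B"
      using N[of n] False \<open>\<sigma> / 2 \<le> B\<close> by simp
    finally show ?thesis
      using z by (simp add: absval_mult)
  qed
  let ?S = "\<lambda>n. \<Sum>i<n. g $ i * z ^ i"
  have "?S (n + Suc k) \<in> {x. absval x \<le> B}" for n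
  proof -
    have "?S (n + Suc k) = g $ 1 * z ^ 1 + (g $ k * z ^ k + (\<Sum>i\<in>{..<n + Suc k} - {1} - {k}. g $ i * z ^ i))"
      using k by (subst sum.remove[of _ 1], simp, simp, subst sum.remove[of _ k]) auto
    also have "\<dots> = (\<Sum>i\<in>{..<n + Suc k} - {1} - {k}. g $ i * z ^ i)"
      using cancel by (simp only: g1 mult_1_left power_one_right add_0_left flip: add.assoc)
    also have "absval \<dots> \<le> B"
      using \<open>\<sigma> / 2 \<le> B\<close> sigma_pos by (intro absval_sum_le[OF char_pos] term_le) auto
    finally show ?thesis by simp
  qed
  moreover have "(\<lambda>n. ?S (n + Suc k)) \<longlonglongrightarrow> fps_value g z"
    using z by (intro LIMSEQ_ignore_initial_segment fps_value_LIMSEQ g_converges) simp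
  ultimately have "fps_value g z \<in> {x. absval x \<le> B}"
    by (rule closed_sequentially[OF closed_absval_le])
  with \<open>B < \<sigma>\<close> show ?thesis by simp
qed

text \<open>
  Newton's method with the constant derivative \<open>1\<close>: a fixed point of \<open>x - g(x)\<close> is a zero of \<open>g\<close>. By
  \<open>g_tangent\<close> this map contracts the disc of radius \<open>\<epsilon> = \<bar>g(z0)\<bar>\<close> about \<open>z0\<close> with
  factor \<open>\<epsilon> / \<sigma>\<close>.
\<close>

lemma zero_on_sphere:
  assumes z0: "absval z0 = \<sigma>" and small: "absval (fps_value g z0) < \<sigma>"
  shows "\<exists>z. absval z = \<sigma> \<and> fps_value g z = 0"
proof -
  define \<epsilon> where "\<epsilon> = absval (fps_value g z0)"
  let ?\<phi> = "\<lambda>x. x - fps_value g x"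
  let ?U = "{x. absval (x - z0) \<le> \<epsilon>}"
  have eps: "0 \<le> \<epsilon>" "\<epsilon> < \<sigma>"
    using small by (auto simp: \<epsilon>_def)
  have sphere: "absval x = \<sigma>" if "x \<in> ?U" for x
    using absval_add_dominant[OF char_pos, of "x - z0" z0] that z0 eps by simp
  have contraction: "absval (?\<phi> x - ?\<phi> y) \<le> \<epsilon> / \<sigma> * absval (x - y)" if "x \<in> ?U" "y \<in> ?U" for x y
  proof -
    have "absval ((x - z0) - (y - z0)) \<le> \<epsilon>"
      using that by (intro absval_diff_le[OF char_pos, of "x - z0" _ "y - z0"]) auto
    then have "absval (x - y) \<le> \<epsilon>"
      by simp
    have "absval (?\<phi> x - ?\<phi> y) = absval (fps_value g x - fps_value g y - (x - y))"
      using absval_diff_commute[of "?\<phi> x - ?\<phi> y" 0] by (simp add: algebra_simps)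
    also have "\<dots> \<le> absval (x - y) * absval (x - y) / \<sigma>"
      using g_tangent[of x y] sphere[OF that(1)] sphere[OF that(2)] by (simp add: power2_eq_square)
    also have "\<dots> \<le> \<epsilon> * absval (x - y) / \<sigma>"
      using \<open>absval (x - y) \<le> \<epsilon>\<close> sigma_pos by (intro divide_right_mono mult_right_mono) auto
    finally show ?thesis by simp
  qed
  have z0U: "z0 \<in> ?U"
    using eps by simp
  have maps: "?\<phi> x \<in> ?U" if "x \<in> ?U" for x
  proof -
    have "absval (?\<phi> x - ?\<phi> z0) \<le> \<epsilon> / \<sigma> * absval (x - z0)"
      by (rule contraction[OF that z0U])
    also have "\<dots> \<le> \<epsilon> / \<sigma> * \<epsilon>"
      using that eps sigma_pos by (intro mult_left_mono) auto
    also have "\<dots> \<le> 1 * \<epsilon>"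
      using eps sigma_pos by (intro mult_right_mono) auto
    finally have "absval (?\<phi> x - ?\<phi> z0) \<le> \<epsilon>"
      by simp
    from absval_diff_le[OF char_pos this, of "fps_value g z0"]
    have "absval ((?\<phi> x - ?\<phi> z0) - fps_value g z0) \<le> \<epsilon>"
      by (simp add: \<epsilon>_def)
    then show ?thesis
      by (simp add: algebra_simps)
  qed
  have U_eq: "?U = cball z0 \<epsilon>"
    by (simp add: cball_def dist_absval absval_diff_commute[of z0])
  have "\<exists>!x\<in>?U. ?\<phi> x = x"
  proof (rule Banach_fix)
    show "complete ?U"
      unfolding U_eq by (simp add: complete_eq_closed)
    show "?U \<noteq> {}" using z0U by blast
    show "0 \<le> \<epsilon> / \<sigma>" "\<epsilon> / \<sigma> < 1"
      using eps sigma_pos by auto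
    show "?\<phi> ` ?U \<subseteq> ?U"
      using maps by blast
    show "dist (?\<phi> x) (?\<phi> y) \<le> \<epsilon> / \<sigma> * dist x y" if "x \<in> ?U" "y \<in> ?U" for x y
      using contraction[OF that] by (simp add: dist_absval)
  qed
  then obtain z where "z \<in> ?U" "?\<phi> z = z"
    by blast
  then show ?thesis
    using sphere by (intro exI[of _ z]) (simp only: diff_eq_eq add_cancel_right_right)
qed

lemma iterate_estimates:
  assumes z: "absval z = \<sigma>"
  shows "absval ((fps_value f ^^ j) z) = \<sigma>" and "absval ((fps_value f ^^ j) z - l ^ j * z) < \<sigma>"
    and "fps_value g z = 0 \<Longrightarrow> fps_value g ((fps_value f ^^ j) z) = 0"
proof (induction j)
  case (Suc j)
  let ?w = "(fps_value f ^^ j) z"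
  note IH = Suc
  {
    case 1
    show ?case using IH(1) absval_f[of ?w] by simp
  next
    case 2
    have "?w \<noteq> 0"
      using IH(1) sigma_pos by auto
    then have "absval (fps_value f ?w - l * ?w) < \<sigma>"
      using f_near_rotation[of ?w] IH(1) by simp
    moreover have "absval (l * (?w - l ^ j * z)) < \<sigma>"
      using IH(2) by (simp add: absval_mult absval_l)
    ultimately have "absval ((fps_value f ?w - l * ?w) + l * (?w - l ^ j * z)) < \<sigma>"
      by (rule absval_add_less[OF char_pos])
    then show ?case
      by (simp add: algebra_simps)
  next
    case 3
    then show ?case
      using g_semiconjugates[of ?w] IH(1,3) by simp
  }
qed (use z sigma_pos in simp_all)

text \<open>
  The point \<open>f^m(z)\<close> is a zero of \<open>g\<close> and nearer than \<open>\<sigma>\<close> to \<open>l ^ m * z\<close>, hence to the zero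
  \<open>z\<close>; by \<open>g_inj_near\<close> the two coincide.
\<close>

lemma zero_is_periodic:
  assumes z: "absval z = \<sigma>" "fps_value g z = 0" and m: "1 \<le> m" "absval (1 - l ^ m) < 1"
  shows "\<exists>\<kappa>\<le>m. periodic_point f \<kappa> z"
proof -
  let ?w = "(fps_value f ^^ m) z"
  have "absval ((1 - l ^ m) * z) < \<sigma>"
    using m z sigma_pos by (simp add: absval_mult)
  then have "absval ((?w - l ^ m * z) - (1 - l ^ m) * z) < \<sigma>"
    by (intro absval_diff_less[OF char_pos] iterate_estimates(2) z(1))
  then have "absval (?w - z) < \<sigma>"
    by (simp add: algebra_simps)
  moreover have "absval ?w \<le> \<sigma>" "fps_value g ?w = 0"
    using iterate_estimates(1,3)[OF z(1)] z(2) by (simp_all only: order_refl)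
  ultimately have returns: "?w = z"
    using g_inj_near[of ?w z] z by (simp only: order_refl)
  let ?P = "\<lambda>n. 1 \<le> n \<and> (fps_value f ^^ n) z = z"
  define \<kappa> where "\<kappa> = Least ?P"
  have "?P m"
    using m returns by simp
  then have "?P \<kappa>" "\<kappa> \<le> m"
    unfolding \<kappa>_def by (rule LeastI[of ?P m], rule Least_le[of ?P m])
  moreover have "\<not> ?P j" if "j < \<kappa>" for j
    using not_less_Least that unfolding \<kappa>_def by blast
  moreover have "fps_converges f ((fps_value f ^^ j) z)" for j
    using iterate_estimates(1)[OF z(1), of j] by (simp add: f_converges)
  ultimately have "periodic_point f \<kappa> z"
    unfolding periodic_point_def by blast
  with \<open>\<kappa> \<le> m\<close> show ?thesis
    by blast
qed

text \<open>
  \<open>f\<close> does not increase distances, so each step adds to the deviation from \<open>l ^ j * (y - z)\<close> an error of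
  the same quadratic size, and in an ultrametric field these errors do not accumulate.
\<close>

lemma iterate_tangent:
  assumes "absval y \<le> \<sigma>" "absval z \<le> \<sigma>"
  shows "absval ((fps_value f ^^ j) y) \<le> \<sigma> \<and> absval ((fps_value f ^^ j) z) \<le> \<sigma> \<and>
    absval ((fps_value f ^^ j) y - (fps_value f ^^ j) z) \<le> absval (y - z) \<and>
    absval ((fps_value f ^^ j) y - (fps_value f ^^ j) z - l ^ j * (y - z)) \<le> (absval (y - z))\<^sup>2 / \<sigma>"
proof (induction j)
  case 0
  show ?case using assms sigma_pos by simp
next
  case (Suc j)
  define Y where "Y = (fps_value f ^^ j) y"
  define Z where "Z = (fps_value f ^^ j) z"
  have IH: "absval Y \<le> \<sigma>" "absval Z \<le> \<sigma>" "absval (Y - Z) \<le> absval (y - z)"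
    "absval (Y - Z - l ^ j * (y - z)) \<le> (absval (y - z))\<^sup>2 / \<sigma>"
    using Suc by (auto simp: Y_def Z_def)
  have yz: "absval (y - z) \<le> \<sigma>"
    by (rule absval_diff_le[OF char_pos assms])
  let ?E = "fps_value f Y - fps_value f Z - l * (Y - Z)"
  have "absval ?E \<le> (absval (Y - Z))\<^sup>2 / \<sigma>"
    by (rule f_tangent[OF IH(1,2)])
  also have "\<dots> \<le> (absval (y - z))\<^sup>2 / \<sigma>"
    using IH(3) sigma_pos by (intro divide_right_mono power_mono) auto
  finally have E: "absval ?E \<le> (absval (y - z))\<^sup>2 / \<sigma>" .
  also have quadratic: "(absval (y - z))\<^sup>2 / \<sigma> \<le> absval (y - z)"
    using mult_left_mono[OF yz absval_nonneg[of "y - z"]] sigma_pos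
    by (simp add: power2_eq_square pos_divide_le_eq)
  finally have "absval (?E + l * (Y - Z)) \<le> absval (y - z)"
    using IH(3) by (intro absval_add_le[OF char_pos]) (simp_all add: absval_mult absval_l)
  moreover have "absval (?E + l * (Y - Z - l ^ j * (y - z))) \<le> (absval (y - z))\<^sup>2 / \<sigma>"
    using E IH(4) by (intro absval_add_le[OF char_pos]) (simp_all add: absval_mult absval_l)
  moreover have "?E + l * (Y - Z - l ^ j * (y - z)) = fps_value f Y - fps_value f Z - l ^ Suc j * (y - z)"
    by (simp add: algebra_simps)
  ultimately show ?case
    using absval_f IH(1,2) by (simp add: Y_def[symmetric] Z_def[symmetric])
qed

lemma has_multiplier_power:
  assumes z: "absval z = \<sigma>"
  shows "has_multiplier f j z (l ^ j)"
  unfolding has_multiplier_def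
proof (rule tendsto_absval_le)
  have "eventually (\<lambda>y. dist y z < \<sigma>) (at z)"
    using sigma_pos by (auto simp: eventually_at)
  then show "eventually (\<lambda>y. absval (((fps_value f ^^ j) y - (fps_value f ^^ j) z) / (y - z) - l ^ j)
      \<le> absval (y - z) / \<sigma>) (at z)"
    using eventually_neq_at_within[of z z UNIV]
  proof eventually_elim
    case (elim y)
    then have near: "absval (y - z) < \<sigma>" and pos: "0 < absval (y - z)"
      by (simp_all add: dist_absval less_le)
    have "absval (z + (y - z)) \<le> \<sigma>"
      using near z by (intro absval_add_le[OF char_pos]) auto
    then have y: "absval y \<le> \<sigma>"
      by simp
    have "((fps_value f ^^ j) y - (fps_value f ^^ j) z) / (y - z) - l ^ j
        = ((fps_value f ^^ j) y - (fps_value f ^^ j) z - l ^ j * (y - z)) / (y - z)"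
      using elim by (simp add: field_simps)
    also have "absval \<dots> \<le> (absval (y - z))\<^sup>2 / \<sigma> / absval (y - z)"
      unfolding absval_divide using iterate_tangent[OF y, of z j] z by (intro divide_right_mono) auto
    also have "\<dots> = absval (y - z) / \<sigma>"
      using pos by (simp add: power2_eq_square)
    finally show ?case .
  qed
  have "((\<lambda>y. absval (y - z) / \<sigma>) \<longlongrightarrow> 0 / \<sigma>) (at z)"
    using tendsto_ident_at[of z UNIV] sigma_pos by (intro tendsto_divide tendsto_const) (auto simp: tendsto_absval_iff)
  then show "((\<lambda>y. absval (y - z) / \<sigma>) \<longlongrightarrow> 0) (at z)"
    by simp
qed

end

lemma has_weierstrass_degree_gauss:
  fixes h :: "'a::abs_value_field fps" and z :: 'a
  assumes degree: "gauss_degree s s k h" and s: "0 < s" and z: "absval z = s"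
    and conv: "\<And>x. absval x \<le> s \<Longrightarrow> fps_converges h x"
  shows "has_weierstrass_degree h s k"
proof -
  have le: "absval (h $ n) * s ^ n \<le> s" and eq: "absval (h $ k) * s ^ k = s"
    and less: "k < n \<Longrightarrow> absval (h $ n) * s ^ n < s" for n
    using degree by (auto simp: gauss_degree_def gauss_bound_def)
  have sup: "(SUP n. absval (h $ n) * s ^ n) = s"
    using le eq by (intro cSup_eq_maximum) (auto intro!: image_eqI[of _ _ k])
  define M where "M = {n. absval (h $ n) * s ^ n = s}"
  have "M \<subseteq> {..k}"
  proof
    fix n
    assume "n \<in> M"
    then show "n \<in> {..k}"
      using less[of n] by (cases "k < n") (auto simp: M_def)
  qed
  then have "finite M"
    by (rule finite_subset) simp
  moreover have "k \<in> M"
    using eq by (simp add: M_def)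
  moreover have "Max M = k"
    using \<open>finite M\<close> \<open>k \<in> M\<close> \<open>M \<subseteq> {..k}\<close> by (intro Max_eqI) auto
  moreover have "s \<in> absval ` (UNIV - {0 :: 'a})"
    by (rule image_eqI[of s absval z]) (use z s in auto)
  ultimately show ?thesis
    unfolding has_weierstrass_degree_def Let_def sup M_def[symmetric] using conv by auto
qed

section \<open>The linearization disc\<close>

lemma powr_inverse_power:
  fixes x :: real
  assumes "0 \<le> x" "0 < n"
  shows "(x powr (1 / real n)) ^ n = x"
proof (cases "x = 0")
  case False
  then have "(x powr (1 / real n)) ^ n = x powr (real n * (1 / real n))"
    using assms by (simp add: powr_powr flip: powr_realpow)
  then show ?thesis
    using assms by simp
qed (use assms in simp)

theorem theorem6:
  fixes \<iota> :: "'a::{abs_value_field, complete_space} alg_closure \<Rightarrow> 'c::{abs_value_field, complete_space}"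
    and p m k :: nat
    and l :: 'a
    and a \<sigma> :: real
    and f :: "'a fps"
  assumes "CHAR('a) = p" and "p > 0"
    and "\<exists>x::'a. x \<noteq> 0 \<and> absval x \<noteq> 1"
    and "completed_alg_closure \<iota>"
    and "\<forall>n\<ge>1. l ^ n \<noteq> 1"
    and "\<exists>n\<ge>1. absval (1 - l ^ n) < 1"
    and "m = mult_order_residue l"
    and "k = min_resonance p l"
    and "a > 0"
    and "f \<in> series_family p l a"
    and "\<sigma> = absval (1 - l ^ m) powr (1 / real (k - 1)) / a"
    and "a = absval (fps_nth f k) powr (1 / real (k - 1))"
    and "\<forall>i. 2 \<le> i \<and> i < k \<longrightarrow> absval (fps_nth f i) < a ^ (i - 1)"
  shows "linearization_disc f (ball 0 \<sigma>) \<and>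
    has_weierstrass_degree (fps_map (\<lambda>x. \<iota> (to_ac x)) (conjugacy f)) \<sigma> k \<and>
    (\<exists>z \<kappa>. z \<in> sphere 0 \<sigma> \<and> \<kappa> \<le> k \<and>
      indifferent_periodic_point (fps_map (\<lambda>x. \<iota> (to_ac x)) f) \<kappa> z \<and>
      has_multiplier (fps_map (\<lambda>x. \<iota> (to_ac x)) f) \<kappa> z (\<iota> (to_ac l) ^ \<kappa>))"
proof -
  define \<rho> where "\<rho> = 1 / a"
  have rho_pos: "0 < \<rho>"
    using assms(9) by (simp add: \<rho>_def)
  note family = assms(10)[unfolded series_family_def mem_Collect_eq]
  have f0: "f $ 0 = 0" and f1: "f $ 1 = l"
    and exps: "\<And>i. 2 \<le> i \<Longrightarrow> \<not> p dvd i \<Longrightarrow> f $ i = 0"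
    using family by auto
  have char_pos: "CHAR('a) > 0"
    using assms(1,2) by simp
  have prime_p: "prime p"
    using prime_CHAR_semidom[OF char_pos] assms(1) by simp
  have m_pos: "1 \<le> m"
    unfolding assms(7) by (rule mult_order_residue_pos[OF char_pos assms(6)])
  have "coprime p m"
    using coprime_mult_order_residue[OF char_pos assms(6)] by (simp only: assms(1,7))
  note resonance = min_resonance_properties[OF this prime_gt_1_nat[OF prime_p] m_pos assms(7), folded assms(8)]
  have k: "2 \<le> k"
    by (rule resonance(1))
  \<comment> \<open>Translates between the weights \<open>a ^ (i - 1)\<close> and Gauss norms at radius \<open>\<rho>\<close>.\<close>
  have weight: "x * \<rho> ^ i = x / a ^ (i - 1) * \<rho>" if "2 \<le> i" for x i
    using that assms(9) by (cases i) (simp_all add: \<rho>_def power_divide)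
  have coeff_le: "absval (f $ i) \<le> a ^ (i - 1)" if "2 \<le> i" for i
  proof -
    have "absval (f $ i) powr (1 / real (i - 1)) \<le> a"
      using family that by (metis (no_types, lifting) atLeast_iff cSUP_upper)
    then have "(absval (f $ i) powr (1 / real (i - 1))) ^ (i - 1) \<le> a ^ (i - 1)"
      by (intro power_mono) auto
    then show ?thesis
      by (subst (asm) powr_inverse_power) (use that in auto)
  qed
  have bound: "gauss_bound \<rho> \<rho> f"
    unfolding gauss_bound_def
  proof
    fix i :: nat
    consider "i = 0" | "i = 1" | "2 \<le> i"
      by linarith
    then show "absval (f $ i) * \<rho> ^ i \<le> \<rho>"
    proof cases
      case 1
      then show ?thesis using assms(9) by (simp add: f0 \<rho>_def)
    next
      case 2
      then show ?thesis
        using absval_residue_torsion[OF char_pos assms(6)] by (simp del: One_nat_def add: f1)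
    next
      case 3
      then show ?thesis
        unfolding weight[OF 3]
        by (intro mult_left_le_one_le) (use coeff_le[OF 3] assms(9) in \<open>auto simp: \<rho>_def\<close>)
    qed
  qed
  have "absval (f $ k) = a ^ (k - 1)"
    using powr_inverse_power[of "absval (f $ k)" "k - 1"] assms(12) k by simp
  then have dominant: "absval (f $ k) * \<rho> ^ k = \<rho>"
    unfolding weight[OF k] using assms(9) by simp
  have below: "absval (f $ i) * \<rho> ^ i < \<rho>" if "2 \<le> i" "i < k" for i
  proof -
    have "absval (f $ i) < a ^ (i - 1)"
      using assms(13) that by blast
    then show ?thesis
      unfolding weight[OF that(1)]
      using mult_strict_right_mono[of "absval (f $ i) / a ^ (i - 1)" 1 \<rho>] rho_pos assms(9)
      by (simp only: pos_divide_less_eq zero_less_power mult_1_left)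
  qed
  interpret R: resonant_series f l p m k \<rho>
    using assms(1,2,5-9) f0 f1 exps bound dominant below by unfold_locales (auto simp: \<rho>_def)
  let ?g = "conjugacy f"
  have sigma: "R.\<sigma> = \<sigma>"
    unfolding R.\<sigma>_def R.d_def assms(11) by (simp add: \<rho>_def)
  note degree = R.gauss_degree_g[unfolded sigma]
  have exponents: "of_nat i * f $ i = 0" "of_nat i * ?g $ i = 0" if "2 \<le> i" for i
    using R.exponents[OF that] R.g_exponents[OF that]
    by (auto simp: of_nat_eq_0_iff_char_dvd assms(1))
  note sigma_props = R.sigma_pos[unfolded sigma] R.sigma_less_r[unfolded sigma]
  have g_bound: "gauss_bound \<sigma> \<sigma> ?g"
    using degree by (simp add: gauss_degree_def)
  interpret K: linearizing_series f ?g l \<sigma> R.r \<rho> "\<rho> / R.d"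
    using R.g0 R.g1 R.g_conj
    by unfold_locales (use char_pos f0 f1 R.absval_l exponents bound g_bound R.gauss_bound_g
      sigma_props R.r_less_rho in auto)

  have disc: "linearization_disc f (ball 0 \<sigma>)"
    unfolding linearization_disc_def
  proof (intro conjI allI impI)
    show "disc_at_0 (ball (0 :: 'a) \<sigma>)"
      using K.sigma_pos by (auto simp: disc_at_0_def)
    show "full_conjugacy_on f (ball 0 \<sigma>)"
      by (rule K.full_conjugacy_ball) (rule refl)
    fix V
    assume V: "disc_at_0 V \<and> full_conjugacy_on f V"
    show "V \<subseteq> ball 0 \<sigma>"
    proof
      fix x
      assume "x \<in> V"
      then have "fps_converges (fps_inv ?g) x"
        using V by (auto simp: full_conjugacy_on_def Let_def)
      then have "\<not> \<sigma> \<le> absval x"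
        using inverse_series_diverges[OF char_pos K.g0 K.g1 degree k K.sigma_pos] by blast
      then show "x \<in> ball 0 \<sigma>"
        by simp
    qed
  qed

  define \<psi> where "\<psi> = (\<lambda>x. \<iota> (to_ac x))"
  have iota: "\<iota> 1 = 1" "\<And>x y. \<iota> (x + y) = \<iota> x + \<iota> y" "\<And>x y. \<iota> (x * y) = \<iota> x * \<iota> y"
    "\<And>x. absval (\<iota> (to_ac x)) = absval x"
    using assms(4) by (auto simp: completed_alg_closure_def)
  have psi: "\<psi> 1 = 1" "\<And>x y. \<psi> (x + y) = \<psi> x + \<psi> y" "\<And>x y. \<psi> (x * y) = \<psi> x * \<psi> y"
    and absval_psi: "\<And>x. absval (\<psi> x) = absval x"
    by (simp_all add: \<psi>_def iota)
  have psi_0: "\<psi> 0 = 0"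
    using absval_psi[of 0] by simp
  have psi_minus: "\<psi> (- x) = - \<psi> x" for x
    using psi(2)[of x "- x"] psi_0 by (simp add: add_eq_0_iff)
  have psi_power: "\<psi> (x ^ n) = \<psi> x ^ n" for x n
    by (induction n) (simp_all add: psi)
  have psi_of_nat: "\<psi> (of_nat n) = of_nat n" for n
    by (induction n) (simp_all add: psi psi_0)
  have "of_nat p = (0 :: 'c)"
    using of_nat_CHAR[where ?'a = 'a] psi_of_nat[of p] by (simp only: assms(1) psi_0)
  then have char_c: "CHAR('c) > 0"
    unfolding CHAR_pos_iff using assms(2) by blast
  let ?F = "fps_map \<psi> f" and ?G = "fps_map \<psi> ?g"
  have map_exponents: "of_nat i * \<psi> x = 0" if "of_nat i * x = 0" for i x
    using arg_cong[OF that, of \<psi>] by (simp add: psi psi_0 psi_of_nat)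
  have map_bound: "gauss_bound s B (fps_map \<psi> h) \<longleftrightarrow> gauss_bound s B h" for s B h
    by (simp add: gauss_bound_def absval_psi)
  have map_degree: "gauss_degree \<sigma> \<sigma> k ?G"
    using degree by (simp add: gauss_degree_def gauss_bound_def absval_psi)
  have map_conj: "?G oo ?F = fps_const (\<psi> l) * ?G"
    by (rule fps_map_conjugates[OF psi(2,3,1) K.conj])
  interpret C: linearizing_series ?F ?G "\<psi> l" \<sigma> R.r \<rho> "\<rho> / R.d"
  proof unfold_locales
    show "?F $ 1 = \<psi> l" "?G $ 1 = 1"
      by (simp_all only: fps_map_nth f1 K.g1 psi(1))
  qed (use char_c f0 K.g0 psi_0 R.absval_l exponents bound g_bound R.gauss_bound_g
      sigma_props R.r_less_rho map_conj in \<open>auto simp: absval_psi map_bound map_exponents\<close>)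

  have g_k: "absval (?g $ k) * \<sigma> ^ (k - 1) = 1"
  proof -
    have "absval (?g $ k) * \<sigma> ^ (k - 1) * \<sigma> = 1 * \<sigma>"
      using R.coeff_sigma_k k by (simp add: sigma mult.assoc flip: power_Suc2)
    then show ?thesis
      using K.sigma_pos by (simp only: mult_cancel_right) auto
  qed
  then have "?g $ k \<noteq> 0"
    by auto
  \<comment> \<open>\<open>z0\<close> is a zero of the dominant part \<open>x + g\<^sub>k x^k\<close> of \<open>g\<close>.\<close>
  obtain w :: "'a alg_closure" where w: "w ^ (k - 1) = to_ac (- 1 / ?g $ k)"
    using nth_root_exists[of "k - 1" "to_ac (- 1 / ?g $ k)"] k by auto
  define z0 where "z0 = \<iota> w"
  have "\<iota> (w ^ n) = z0 ^ n" for n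
    by (induction n) (simp_all add: iota z0_def)
  then have z0_power: "z0 ^ (k - 1) = \<psi> (- 1 / ?g $ k)"
    using w by (metis \<psi>_def)
  have "absval z0 ^ (k - 1) = 1 / absval (?g $ k)"
    using arg_cong[OF z0_power, of absval] by (simp add: absval_psi absval_divide)
  also have "\<dots> = \<sigma> ^ (k - 1)"
    using g_k \<open>?g $ k \<noteq> 0\<close> by (subst nonzero_divide_eq_eq) (simp_all add: mult.commute)
  finally have z0: "absval z0 = \<sigma>"
    using power_eq_imp_eq_base[of "absval z0" "k - 1" \<sigma>] K.sigma_pos k by simp
  have "?G $ k * z0 ^ (k - 1) = \<psi> (?g $ k * (- 1 / ?g $ k))"
    by (simp only: z0_power fps_map_nth psi(3))
  also have "\<dots> = - 1"
    using \<open>?g $ k \<noteq> 0\<close> by (simp add: psi_minus psi(1))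
  finally have "?G $ k * z0 ^ (k - 1) * z0 = - z0"
    by simp
  then have cancel: "z0 + ?G $ k * z0 ^ k = 0"
    using k by (simp add: mult.assoc flip: power_Suc2)
  have "absval (fps_value ?G z0) < \<sigma>"
    using C.value_at_approximate_zero[OF z0 _ cancel] k R.coeff_sigma_less[unfolded sigma]
    by (simp add: absval_psi)
  then obtain z where z: "absval z = \<sigma>" "fps_value ?G z = 0"
    using C.zero_on_sphere[OF z0] by blast
  have "1 - \<psi> l ^ m = \<psi> (1 - l ^ m)"
    using psi(2)[of "1 - l ^ m" "l ^ m"] by (simp add: psi psi_power algebra_simps)
  then have "absval (1 - \<psi> l ^ m) < 1"
    using R.d_less_1 by (simp add: absval_psi R.d_def)
  then obtain \<kappa> where \<kappa>: "\<kappa> \<le> m" "periodic_point ?F \<kappa> z"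
    using C.zero_is_periodic[OF z m_pos] by blast
  have "m \<le> k - 1"
    using resonance(3) k by (intro dvd_imp_le) auto
  then have "\<kappa> \<le> k"
    using \<kappa> by simp
  moreover have "indifferent_periodic_point ?F \<kappa> z"
    unfolding indifferent_periodic_point_def
    using \<kappa>(2) C.has_multiplier_power[OF z(1), of \<kappa>]
    by (intro conjI exI[of _ "\<psi> l ^ \<kappa>"]) (auto simp: C.absval_l)
  moreover have "has_weierstrass_degree ?G \<sigma> k"
    by (rule has_weierstrass_degree_gauss[OF map_degree C.sigma_pos z0 C.g_converges])
  ultimately have "has_weierstrass_degree ?G \<sigma> k \<and>
    (\<exists>z \<kappa>. z \<in> sphere 0 \<sigma> \<and> \<kappa> \<le> k \<and> indifferent_periodic_point ?F \<kappa> z \<and>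
      has_multiplier ?F \<kappa> z (\<psi> l ^ \<kappa>))"
    using z(1) C.has_multiplier_power[OF z(1), of \<kappa>] by (auto intro!: exI[of _ z] exI[of _ \<kappa>])
  with disc show ?thesis
    by (simp only: \<psi>_def)
qed

end
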